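(* For all integers $d\ge 0$, $m\ge 1$ and $h\ge 0$, the linear system $\mathcal{L}_d(m^{9^h})$ of plane curves of degree $d$ with multiplicity at least $m$ at each of $9^h$ points in general position is non-special.
   Context: Work over $\mathbb{C}$. For points $q_1,\dots,q_n$ of the projective plane $\mathbb{P}^2$, consider the linear system of plane curves of degree $d$ having multiplicity at least $m$ at each $q_i$. It is the projectivization of the vector space of homogeneous polynomials of degree $d$ in three variables (including $0$) that vanish to order at least $m$ at each $q_i$, i.e. whose Taylor expansion at each $q_i$ in local affine coordinates has no terms of degree less than $m$. Its dimension is the dimension of this vector space minus $1$, so the dimension is $-1$ exactly when the system is empty. The notation $\mathcal{L}_d(m^n)$ denotes this system for $n$ points $q_1,\dots,q_n$ in general position (so in $\mathcal{L}_d(m^{9^h})$ the number of points is $n=9^h$). Its dimension $l$ is the minimum value over all $n$-tuples of distinct points, which is attained on a nonempty Zariski open set of $n$-tuples. The virtual dimension is $v(d,m,n)=\frac{d(d+3)}{2}-n\,\frac{m(m+1)}{2}$, and the expected dimension is $e(d,m,n)=\max\{-1,\,v(d,m,n)\}$. One always has $l\ge e$. The system $\mathcal{L}_d(m^n)$ is called non-special if $l=e(d,m,n)$, and special otherwise. *)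

theory Defs
  imports "HOL-Analysis.Analysis" "HOL-Library.Poly_Mapping"
begin

text \<open>Variables are indexed by the three-element type \<open>3\<close>; a monomial is its exponent vector.\<close>

type_synonym monomial3 = "3 \<Rightarrow>\<^sub>0 nat"
type_synonym poly3 = "monomial3 \<Rightarrow>\<^sub>0 complex"

definition mon_degree :: "monomial3 \<Rightarrow> nat" where
  "mon_degree e = (\<Sum>j\<in>UNIV. Poly_Mapping.lookup e j)"

definition poly_const :: "complex \<Rightarrow> poly3" where
  "poly_const c = Poly_Mapping.single 0 c"

definition poly_var :: "3 \<Rightarrow> poly3" where
  "poly_var j = Poly_Mapping.single (Poly_Mapping.single j 1) 1"

definition poly_scale :: "complex \<Rightarrow> poly3 \<Rightarrow> poly3" where
  "poly_scale c F = Poly_Mapping.map (\<lambda>a. c * a) F"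

lemma lookup_poly_scale: "Poly_Mapping.lookup (poly_scale c F) e = c * Poly_Mapping.lookup F e"
  by (simp add: poly_scale_def Poly_Mapping.map.rep_eq when_def)

global_interpretation poly3: vector_space poly_scale
  by unfold_locales
    (auto intro!: poly_mapping_eqI simp: lookup_poly_scale lookup_add algebra_simps)

definition poly_subst :: "(3 \<Rightarrow> poly3) \<Rightarrow> poly3 \<Rightarrow> poly3" where
  "poly_subst g F =
    (\<Sum>e\<in>Poly_Mapping.keys F.
      poly_const (Poly_Mapping.lookup F e) * (\<Prod>j\<in>UNIV. g j ^ Poly_Mapping.lookup e j))"

definition homogeneous :: "nat \<Rightarrow> poly3 \<Rightarrow> bool" where
  "homogeneous d F \<longleftrightarrow> (\<forall>e\<in>Poly_Mapping.keys F. mon_degree e = d)"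

definition proportional :: "complex ^ 3 \<Rightarrow> complex ^ 3 \<Rightarrow> bool" where
  "proportional v w \<longleftrightarrow> v \<noteq> 0 \<and> w \<noteq> 0 \<and> (\<exists>c. w = c *s v)"

lemma part_equivp_proportional: "part_equivp proportional"
proof (rule part_equivpI)
  have "proportional (axis 1 1) (axis 1 1)"
    unfolding proportional_def by (auto simp: axis_eq_0_iff intro!: exI[of _ 1])
  then show "\<exists>v. proportional v v" by blast
  show "symp proportional"
  proof (rule sympI)
    fix v w assume "proportional v w"
    then obtain c where c: "v \<noteq> 0" "w \<noteq> 0" "w = c *s v"
      unfolding proportional_def by blast
    then have "c \<noteq> 0" by auto
    then have "v = inverse c *s w" using c by (simp add: vector_smult_assoc)
    then show "proportional w v" using c unfolding proportional_def by blast
  qed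
  show "transp proportional"
    unfolding proportional_def by (rule transpI) (metis vector_smult_assoc)
qed

quotient_type proj_plane = "complex ^ 3" / partial: proportional
  by (rule part_equivp_proportional)

text \<open>
  If \<open>v $ i \<noteq> 0\<close>, the point with homogeneous coordinates \<open>v\<close> lies in the affine chart in which the
  \<open>i\<close>-th coordinate is \<open>1\<close>, and it has affine coordinates \<open>v $ j / v $ i\<close> for \<open>j \<noteq> i\<close>.  The following is
  the dehomogenisation of \<open>F\<close> in this chart, expanded at the point: the variables with index
  \<open>j \<noteq> i\<close> are the two local affine coordinates centred there, and the \<open>i\<close>-th variable
  does not occur.
\<close>

definition taylor_expansion :: "3 \<Rightarrow> complex ^ 3 \<Rightarrow> poly3 \<Rightarrow> poly3" where
  "taylor_expansion i v F =
    poly_subst (\<lambda>j. if j = i then 1 else poly_const (v $ j / v $ i) + poly_var j) F"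

text \<open>The condition below does not depend on the chosen chart; it is required in each of
  the standard charts containing the point.\<close>

lift_definition vanishes_to_order :: "nat \<Rightarrow> poly3 \<Rightarrow> proj_plane \<Rightarrow> bool" is
  "\<lambda>m F v. \<forall>i. v $ i \<noteq> 0 \<longrightarrow>
     (\<forall>e\<in>Poly_Mapping.keys (taylor_expansion i v F). m \<le> mon_degree e)"
proof -
  fix m F v w assume "proportional v w"
  then obtain c where c: "w \<noteq> 0" "w = c *s v"
    unfolding proportional_def by blast
  then have "c \<noteq> 0" by auto
  then have "taylor_expansion i v F = taylor_expansion i w F" "v $ i \<noteq> 0 \<longleftrightarrow> w $ i \<noteq> 0" for i
    using c by (simp_all add: taylor_expansion_def vector_smult_component cong: if_cong)
  then show "(\<forall>i. v $ i \<noteq> 0 \<longrightarrow>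
       (\<forall>e\<in>Poly_Mapping.keys (taylor_expansion i v F). m \<le> mon_degree e)) \<longleftrightarrow>
     (\<forall>i. w $ i \<noteq> 0 \<longrightarrow>
       (\<forall>e\<in>Poly_Mapping.keys (taylor_expansion i w F). m \<le> mon_degree e))"
    by simp
qed

definition linear_system :: "nat \<Rightarrow> nat \<Rightarrow> nat \<Rightarrow> (nat \<Rightarrow> proj_plane) \<Rightarrow> poly3 set" where
  "linear_system d m n q = {F. homogeneous d F \<and> (\<forall>i<n. vanishes_to_order m F (q i))}"

definition linear_system_dim :: "nat \<Rightarrow> nat \<Rightarrow> nat \<Rightarrow> (nat \<Rightarrow> proj_plane) \<Rightarrow> int" where
  "linear_system_dim d m n q = int (poly3.dim (linear_system d m n q)) - 1"

text \<open>Dimension for points in general position: the minimum over all \<open>n\<close>-tuples of distinct points.\<close>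

definition general_dim :: "nat \<Rightarrow> nat \<Rightarrow> nat \<Rightarrow> int" where
  "general_dim d m n =
    (LEAST l. \<exists>q. inj_on q {..<n} \<and> l = linear_system_dim d m n q)"

text \<open>Both divisions are exact.\<close>

definition virtual_dim :: "nat \<Rightarrow> nat \<Rightarrow> nat \<Rightarrow> int" where
  "virtual_dim d m n = int (d * (d + 3) div 2) - int n * int (m * (m + 1) div 2)"

definition expected_dim :: "nat \<Rightarrow> nat \<Rightarrow> nat \<Rightarrow> int" where
  "expected_dim d m n = max (- 1) (virtual_dim d m n)"

definition non_special :: "nat \<Rightarrow> nat \<Rightarrow> nat \<Rightarrow> bool" where
  "non_special d m n \<longleftrightarrow> general_dim d m n = expected_dim d m n"

end

theory Submission
  imports Defs "HOL-Library.Function_Algebras"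
begin

text \<open>
  A linear system can only be larger than expected, since each point imposes at most
  \<open>m * (m + 1) div 2\<close> conditions (\<open>linear_system_dim_ge\<close>).  It remains to find \<open>9 ^ h\<close> points whose conditions
  are independent, or else exclude all curves of degree \<open>d\<close>: they have maximal rank.  This goes
  by induction on \<open>h\<close>, for fixed \<open>d\<close> and all \<open>m\<close> at once.  The step from \<open>n\<close> to \<open>9 n\<close> points lets nine points
  collide at each of \<open>n\<close> general points.

  For one collision, put the nine points on the cubic \<open>y = (x + \<sigma> y) ^ 3\<close>, which has a cusp at infinity,
  and choose them so that their sum in the additive group of this cubic is not zero.  Then the curves of degree \<open>3 m\<close> with nine
  \<open>m\<close>-fold points there reduce to the cubic taken \<open>m\<close> times (\<open>multiple_of_cubic_power\<close>), so the nine fat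
  points impose independent conditions in degree \<open>3 m\<close>.  Shrinking the configuration to a
  point \<open>q\<close>, the limits of curves with multiplicity \<open>m\<close> at the nine points are curves with multiplicity
  \<open>3 m\<close> at \<open>q\<close> whose leading form of degree \<open>3 m\<close> is proportional to the leading form
  \<open>(x + \<sigma> y) ^ (3 m)\<close> of the multiple cubic (\<open>collision_family\<close>).  The number of conditions is preserved:
  \<open>3 m\<close> extra conditions are imposed on the leading form.

  By semicontinuity (\<open>cofinite_rank_ge\<close>) it suffices to bound from below the number of conditions in the
  limit.  The parameter \<open>\<sigma>\<close> can be chosen separately at each point.  For general \<open>\<sigma>\<close>, the \<open>3 m\<close> extra
  conditions at a point are either independent of the conditions imposed so far or equivalent to
  the vanishing of the whole leading form (\<open>cofinite_power_conditions_rank\<close>), because powers of linear forms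
  are contained in no hyperplane.  In the second case the point has become one of multiplicity
  \<open>3 m + 1\<close>.  Hence the rank in the limit is at least \<open>G j + 3 m * (n - j)\<close> for some \<open>j\<close>, where \<open>G j\<close> is the
  rank for \<open>j\<close> general points of multiplicity \<open>3 m + 1\<close> and \<open>n - j\<close> of multiplicity \<open>3 m\<close>.  The points being
  general, \<open>G\<close> is concave, and so the bound is smallest at \<open>j = 0\<close> or \<open>j = n\<close>.  There the induction
  hypothesis applies, to the multiplicities \<open>3 m\<close> and \<open>3 m + 1\<close> (\<open>max_rank_nine_times\<close>).
\<close>

section \<open>Dimension of finitely generated sets of vectors\<close>

text \<open>The ambient vector spaces below have infinite dimension, but all sets of vectors considered in
  them are finite or lie in the span of a finite set.\<close>

context vector_space
begin

lemma dim_insert_finite: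
  assumes "finite S"
  shows "dim (insert x S) = (if x \<in> span S then dim S else Suc (dim S))"
proof (cases "x \<in> span S")
  case True
  then have "dim (insert x S) = dim S" by (intro span_eq_dim span_redundant)
  with True show ?thesis by simp
next
  case False
  obtain B where B: "B \<subseteq> S" "independent B" "S \<subseteq> span B" "card B = dim S"
    by (rule basis_exists)
  have span: "span B = span S" unfolding span_eq using B span_superset[of S] by auto
  have ind: "independent (insert x B)" using B False span by (simp add: independent_insertI)
  have "x \<notin> B" using False span span_base by auto
  have "finite B" by (rule finite_subset[OF B(1) assms])
  have "span (insert x B) = span (insert x S)"
    using span by (simp add: span_insert)
  then have "dim (insert x S) = dim (insert x B)" by (intro span_eq_dim) simp
  also have "\<dots> = card (insert x B)" using ind by (rule dim_eq_card_independent)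
  finally have "dim (insert x S) = card (insert x B)" .
  then show ?thesis using False B \<open>x \<notin> B\<close> \<open>finite B\<close> by simp
qed

lemma dim_mono_finite:
  assumes "finite T" "S \<subseteq> span T"
  shows "dim S \<le> dim T"
proof -
  obtain B where B: "B \<subseteq> T" "independent B" "T \<subseteq> span B" "card B = dim T"
    by (rule basis_exists)
  have "finite B" by (rule finite_subset[OF B(1) assms(1)])
  moreover have "span T \<subseteq> span B"
    using B(3) by (intro span_minimal) auto
  ultimately show ?thesis using dim_le_card[of S B] B(4) assms(2) by auto
qed

text \<open>A vector that enlarges the span of a set also enlarges the span of each of its subsets; hence
  adding \<open>B\<close> raises the dimension of \<open>A\<close> at least as much as that of \<open>A \<union> C\<close>.\<close>

lemma dim_submodular:
  assumes "finite A" "finite B" "finite C"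
  shows "dim (A \<union> B \<union> C) + dim A \<le> dim (A \<union> B) + dim (A \<union> C)"
  using assms(2)
proof (induction B)
  case empty
  then show ?case by simp
next
  case (insert x B)
  have "dim (insert x (A \<union> B \<union> C)) + dim (A \<union> B) \<le> dim (insert x (A \<union> B)) + dim (A \<union> B \<union> C)"
    using span_mono[of "A \<union> B" "A \<union> B \<union> C"] assms insert.hyps by (auto simp: dim_insert_finite)
  with insert.IH show ?case by simp
qed

lemma span_Un_image_explicit:
  fixes c :: "nat \<Rightarrow> 'b"
  assumes "x \<in> span (S \<union> c ` {..<n})"
  shows "\<exists>\<phi>. x - (\<Sum>i<n. scale (\<phi> i) (c i)) \<in> span S"
  using assms
proof (induction n arbitrary: x)
  case 0
  then show ?case by simp
next
  case (Suc n)
  have "x \<in> span (insert (c n) (S \<union> c ` {..<n}))" using Suc.prems by (simp add: lessThan_Suc)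
  then obtain k where "x - scale k (c n) \<in> span (S \<union> c ` {..<n})" by (auto simp: span_breakdown_eq)
  then obtain \<phi> where \<phi>: "x - scale k (c n) - (\<Sum>i<n. scale (\<phi> i) (c i)) \<in> span S"
    using Suc.IH by blast
  have sum: "(\<Sum>i<Suc n. scale ((\<phi>(n := k)) i) (c i)) = (\<Sum>i<n. scale (\<phi> i) (c i)) + scale k (c n)"
    by simp
  have "x - (\<Sum>i<Suc n. scale ((\<phi>(n := k)) i) (c i))
      = x - scale k (c n) - (\<Sum>i<n. scale (\<phi> i) (c i))"
    unfolding sum by (rule diff_add_eq_diff_diff_swap)
  with \<phi> have "x - (\<Sum>i<Suc n. scale ((\<phi>(n := k)) i) (c i)) \<in> span S"
    by (simp only:)
  then show ?case by blast
qed

lemma dim_hyperplane: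
  fixes f :: "'b \<Rightarrow> 'a"
  assumes U: "subspace U" "finite E" "U \<subseteq> span E"
    and f: "\<And>x y. f (x + y) = f x + f y" "\<And>c x. f (scale c x) = c * f x"
  shows "dim U \<le> Suc (dim {x \<in> U. f x = 0})"
proof -
  let ?K = "{x \<in> U. f x = 0}"
  obtain B where B: "B \<subseteq> ?K" "independent B" "?K \<subseteq> span B" "card B = dim ?K"
    by (rule basis_exists)
  have fB: "finite B" using independent_span_bound[OF U(2) B(2)] B(1) U(3) by blast
  have f_diff: "f (x - y) = f x - f y" for x y using f(1)[of "x - y" y] by (simp add: eq_diff_eq)
  show ?thesis
  proof (cases "\<exists>x0\<in>U. f x0 \<noteq> 0")
    case True
    then obtain x0 where x0: "x0 \<in> U" "f x0 \<noteq> 0" by blast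
    have "U \<subseteq> span (insert x0 B)"
    proof
      fix x assume x: "x \<in> U"
      have "x - scale (f x / f x0) x0 \<in> ?K"
        using x x0 U(1) by (simp add: subspace_diff subspace_scale f_diff f(2))
      with B show "x \<in> span (insert x0 B)" by (auto simp: span_breakdown_eq)
    qed
    then have "dim U \<le> dim (insert x0 B)" using fB by (intro dim_mono_finite) auto
    also have "\<dots> \<le> Suc (dim B)" using fB by (simp add: dim_insert_finite)
    also have "dim B = dim ?K" using B by (simp add: dim_eq_card_independent)
    finally show ?thesis by simp
  next
    case False
    then have "?K = U" by auto
    then show ?thesis by simp
  qed
qed

lemma dim_common_kernel_ge:
  fixes f :: "'i \<Rightarrow> 'b \<Rightarrow> 'a"
  assumes J: "finite J" and U: "subspace U" "finite E" "U \<subseteq> span E"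
    and f: "\<And>j x y. f j (x + y) = f j x + f j y" "\<And>j c x. f j (scale c x) = c * f j x"
  shows "dim U \<le> dim {x \<in> U. \<forall>j\<in>J. f j x = 0} + card J"
  using J
proof (induction J)
  case empty
  then show ?case by simp
next
  case (insert j J)
  let ?V = "{x \<in> U. \<forall>j\<in>J. f j x = 0}"
  have "f j 0 = 0" for j using f(2)[of j 0 0] by simp
  then have "subspace ?V"
    using U(1) by (intro subspaceI CollectI conjI ballI) (simp_all add: subspace_0 subspace_add subspace_scale f)
  then have "dim ?V \<le> Suc (dim {x \<in> ?V. f j x = 0})"
    using U(2,3) by (intro dim_hyperplane[of ?V E "f j"] f) auto
  also have "{x \<in> ?V. f j x = 0} = {x \<in> U. \<forall>j\<in>insert j J. f j x = 0}" by auto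
  finally have "dim ?V \<le> Suc (dim {x \<in> U. \<forall>j\<in>insert j J. f j x = 0})" .
  moreover have "dim U \<le> dim ?V + card J" by (rule insert.IH)
  moreover have "card (insert j J) = Suc (card J)" using insert.hyps by simp
  ultimately show ?case by linarith
qed

text \<open>The vectors dual to the linear forms are independent modulo the common kernel, because the forms
  separate them and vanish on it.\<close>

lemma dim_common_kernel_le:
  fixes f :: "'i \<Rightarrow> 'b \<Rightarrow> 'a"
  assumes J: "finite J" and E: "finite E" and L: "L \<subseteq> span E"
    and f: "\<And>j x y. f j (x + y) = f j x + f j y" "\<And>j c x. f j (scale c x) = c * f j x"
    and dual: "\<And>j. j \<in> J \<Longrightarrow> F j \<in> span E"
      "\<And>i j. i \<in> J \<Longrightarrow> j \<in> J \<Longrightarrow> f i (F j) = (if i = j then 1 else 0)"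
    and ker: "\<And>j x. j \<in> J \<Longrightarrow> x \<in> L \<Longrightarrow> f j x = 0"
  shows "dim L + card J \<le> card E"
proof -
  obtain B where B: "B \<subseteq> L" "independent B" "L \<subseteq> span B" "card B = dim L"
    by (rule basis_exists)
  have fB: "finite B" using independent_span_bound[OF E B(2)] B(1) L by blast
  have f0: "f j 0 = 0" for j using f(2)[of j 0 0] by simp
  have "dim (B \<union> F ` J') = dim B + card J'" if "J' \<subseteq> J" for J'
    using finite_subset[OF that J] that
  proof (induction J')
    case (insert j J')
    have "f j x = 0" if "x \<in> span (B \<union> F ` J')" for x
      using that
    proof (induction rule: span_induct_alt)
      case (step c x y)
      have "f j x = 0"
        using step.hyps ker[of j x] dual(2)[of j] insert.hyps insert.prems B(1) by auto
      then show ?case using step by (simp add: f)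
    qed (simp add: f0)
    then have "F j \<notin> span (B \<union> F ` J')" using dual(2)[of j j] insert.prems by auto
    then show ?case using insert fB by (simp add: dim_insert_finite)
  qed simp
  from this[of J] have "dim L + card J = dim (B \<union> F ` J)"
    using B by (simp add: dim_eq_card_independent)
  also have "\<dots> \<le> card E" using B L dual E by (intro dim_le_card) auto
  finally show ?thesis .
qed

end

text \<open>A linear functional on polynomials in \<open>x\<close> and \<open>y\<close> is encoded as the function that lists its
  values on the monomials.  Conditions on polynomials thus become vectors, and the number of
  independent conditions in a set is its rank.\<close>

definition fscale :: "complex \<Rightarrow> ('a \<Rightarrow> complex) \<Rightarrow> 'a \<Rightarrow> complex" where
  "fscale c f = (\<lambda>x. c * f x)"

lemma fscale_apply: "fscale c f x = c * f x" by (simp add: fscale_def)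

global_interpretation fv: vector_space fscale
  by unfold_locales (auto simp: fscale_apply fun_eq_iff algebra_simps)

abbreviation rk :: "('a \<Rightarrow> complex) set \<Rightarrow> nat" where "rk \<equiv> fv.dim"

section \<open>Rank of vectors depending polynomially on a parameter\<close>

definition pairing :: "'a set \<Rightarrow> ('a \<Rightarrow> complex) \<Rightarrow> ('a \<Rightarrow> complex) \<Rightarrow> complex" where
  "pairing \<Delta> f v = (\<Sum>x\<in>\<Delta>. f x * v x)"

lemma pairing_add: "pairing \<Delta> f (v + w) = pairing \<Delta> f v + pairing \<Delta> f w"
  and pairing_diff: "pairing \<Delta> f (v - w) = pairing \<Delta> f v - pairing \<Delta> f w"
  and pairing_scale: "pairing \<Delta> f (fscale c v) = c * pairing \<Delta> f v"
  by (simp_all add: pairing_def fscale_apply algebra_simps sum.distrib sum_subtractf sum_distrib_left)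

definition supported :: "'a set \<Rightarrow> ('a \<Rightarrow> complex) \<Rightarrow> bool" where
  "supported \<Delta> v \<longleftrightarrow> (\<forall>x. x \<notin> \<Delta> \<longrightarrow> v x = 0)"

lemma pairing_zero_on_span:
  assumes "v \<in> fv.span S" "\<And>s. s \<in> S \<Longrightarrow> pairing \<Delta> f s = 0"
  shows "pairing \<Delta> f v = 0"
  using assms(1)
proof (rule fv.span_induct_alt)
  show "pairing \<Delta> f (fscale c x + y) = 0" if "x \<in> S" "pairing \<Delta> f y = 0" for c x y
    using that by (simp add: pairing_add pairing_scale assms(2))
qed (simp add: pairing_def)

lemma sum_fun_apply: "(\<Sum>i\<in>A. f i) x = (\<Sum>i\<in>A. f i x)" for f :: "'i \<Rightarrow> 'a \<Rightarrow> complex"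
  by (induction A rule: infinite_finite_induct) auto

text \<open>A linear form on the ambient space restricts, on vectors supported on a finite set, to the
  pairing with the vector of its values at the coordinate vectors.\<close>

lemma independent_prescribed_pairing:
  assumes "finite \<Delta>" "fv.independent B" "\<And>b. b \<in> B \<Longrightarrow> supported \<Delta> b"
  shows "\<exists>f. \<forall>b\<in>B. pairing \<Delta> f b = \<phi> b"
proof -
  interpret pr: vector_space_pair "fscale :: complex \<Rightarrow> ('a \<Rightarrow> complex) \<Rightarrow> 'a \<Rightarrow> complex" "(*) :: complex \<Rightarrow> complex \<Rightarrow> complex"
    by unfold_locales (auto simp: algebra_simps)
  obtain g where g: "Vector_Spaces.linear fscale (*) g" "\<forall>b\<in>B. g b = \<phi> b"
    using pr.linear_independent_extend[OF assms(2), of \<phi>] by blast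
  let ?e = "\<lambda>x y. if y = x then 1 else (0::complex)"
  have "pairing \<Delta> (\<lambda>x. g (?e x)) b = \<phi> b" if b: "b \<in> B" for b
  proof -
    have "b = (\<Sum>x\<in>\<Delta>. fscale (b x) (?e x))"
    proof
      fix y
      have "(\<Sum>x\<in>\<Delta>. fscale (b x) (?e x)) y = (\<Sum>x\<in>\<Delta>. if y = x then b x else 0)"
        by (simp add: sum_fun_apply fscale_apply if_distrib cong: if_cong)
      also have "\<dots> = b y"
        using assms(1) assms(3)[OF b] by (simp add: sum.delta supported_def)
      finally show "b y = (\<Sum>x\<in>\<Delta>. fscale (b x) (?e x)) y" by simp
    qed
    then have "g b = g (\<Sum>x\<in>\<Delta>. fscale (b x) (?e x))" by simp
    also have "\<dots> = (\<Sum>x\<in>\<Delta>. b x * g (?e x))"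
      using g(1) by (simp add: pr.linear_sum pr.linear_scale)
    finally show ?thesis using g(2) b by (simp add: pairing_def mult.commute)
  qed
  then show ?thesis by blast
qed

lemma separating_pairing:
  assumes "finite \<Delta>" "\<And>s. s \<in> S \<Longrightarrow> supported \<Delta> s" "supported \<Delta> w" "w \<notin> fv.span S"
  shows "\<exists>f. (\<forall>s\<in>S. pairing \<Delta> f s = 0) \<and> pairing \<Delta> f w = 1"
proof -
  obtain B where B: "B \<subseteq> S" "fv.independent B" "S \<subseteq> fv.span B"
    by (rule fv.maximal_independent_subset)
  have w: "w \<notin> fv.span B" using assms(4) fv.span_mono[OF B(1)] by blast
  then have wB: "w \<notin> B" using fv.span_base by blast
  obtain f where f: "\<forall>b\<in>insert w B. pairing \<Delta> f b = (if b = w then 1 else 0)"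
    using independent_prescribed_pairing[of \<Delta> "insert w B" "\<lambda>b. if b = w then 1 else 0"]
      assms B w by (auto simp: fv.independent_insertI subset_iff)
  have "pairing \<Delta> f s = 0" if "s \<in> S" for s
  proof (rule pairing_zero_on_span)
    show "s \<in> fv.span B" using that B(3) by blast
  qed (use f wB in auto)
  then show ?thesis using f by auto
qed

definition is_poly :: "(complex \<Rightarrow> complex) \<Rightarrow> bool" where
  "is_poly g \<longleftrightarrow> (\<exists>p. \<forall>t. g t = poly p t)"

lemma is_poly_const: "is_poly (\<lambda>t. c)"
  unfolding is_poly_def by (rule exI[of _ "[:c:]"]) simp

lemma is_poly_id: "is_poly (\<lambda>t. t)"
  unfolding is_poly_def by (rule exI[of _ "[:0,1:]"]) simp

lemma is_poly_add: "is_poly f \<Longrightarrow> is_poly g \<Longrightarrow> is_poly (\<lambda>t. f t + g t)"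
  unfolding is_poly_def by (metis poly_add)

lemma is_poly_mult: "is_poly f \<Longrightarrow> is_poly g \<Longrightarrow> is_poly (\<lambda>t. f t * g t)"
  unfolding is_poly_def by (metis poly_mult)

lemma is_poly_diff: "is_poly f \<Longrightarrow> is_poly g \<Longrightarrow> is_poly (\<lambda>t. f t - g t)"
  unfolding is_poly_def by (metis poly_diff)

lemma is_poly_power: "is_poly f \<Longrightarrow> is_poly (\<lambda>t. f t ^ n)"
  unfolding is_poly_def by (metis poly_power)

lemma is_poly_sum: "(\<And>i. i \<in> A \<Longrightarrow> is_poly (f i)) \<Longrightarrow> is_poly (\<lambda>t. \<Sum>i\<in>A. f i t)"
  by (induction A rule: infinite_finite_induct) (auto intro: is_poly_const is_poly_add)

lemmas is_poly_intros = is_poly_const is_poly_id is_poly_add is_poly_mult is_poly_diff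
  is_poly_power is_poly_sum

lemma is_poly_finite_zeros:
  assumes "is_poly g" "g t0 \<noteq> 0"
  shows "finite {t. g t = 0}"
proof -
  obtain p where p: "\<And>t. g t = poly p t" using assms(1) unfolding is_poly_def by blast
  then have "p \<noteq> 0" using assms(2) by auto
  then show ?thesis using poly_roots_finite[of p] by (simp add: p)
qed

lemma is_poly_pairing:
  assumes "\<And>x. is_poly (\<lambda>t. v t x)"
  shows "is_poly (\<lambda>t. pairing \<Delta> f (v t))"
  unfolding pairing_def by (intro is_poly_intros assms)

text \<open>Induction on the family, by elimination.  A form \<open>f\<close> that takes the value \<open>1\<close> on \<open>v j t0\<close> and
  kills the other \<open>v i t0\<close> is used to clear \<open>f\<close> from all \<open>v i t\<close> with \<open>i \<noteq> j\<close>.  Multiplying through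
  by \<open>p t\<close> instead of dividing keeps the family polynomial, and it does not change
  its value at \<open>t0\<close>, where \<open>p\<close> is \<open>1\<close>.\<close>

lemma cofinite_rank_ge_independent:
  fixes v :: "'i \<Rightarrow> complex \<Rightarrow> 'a \<Rightarrow> complex"
  assumes "finite \<Delta>" "finite J"
    and "\<And>i x. i \<in> J \<Longrightarrow> is_poly (\<lambda>t. v i t x)"
    and "\<And>i t. i \<in> J \<Longrightarrow> supported \<Delta> (v i t)"
    and "inj_on (\<lambda>i. v i t0) J" "fv.independent ((\<lambda>i. v i t0) ` J)"
  shows "finite {t. rk ((\<lambda>i. v i t) ` J) < card J}"
  using assms(2-)
proof (induction J arbitrary: v)
  case empty
  then show ?case by simp
next
  case (insert j J)
  let ?B = "(\<lambda>i. v i t0) ` J"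
  have "v j t0 \<notin> ?B" using insert.prems(3) insert.hyps by auto
  then have jB: "v j t0 \<notin> fv.span ?B" using insert.prems(4) by (simp add: fv.independent_insert)
  obtain f where f: "\<forall>s\<in>?B. pairing \<Delta> f s = 0" "pairing \<Delta> f (v j t0) = 1"
    using separating_pairing[OF assms(1) _ _ jB] insert.prems(2) by blast
  define p where "p t = pairing \<Delta> f (v j t)" for t
  define w where "w i t = fscale (p t) (v i t) - fscale (pairing \<Delta> f (v i t)) (v j t)" for i t
  have w0: "w i t0 = v i t0" if "i \<in> J" for i
    using f that by (auto simp: w_def p_def fscale_apply fun_eq_iff)
  have p_poly: "is_poly p" unfolding p_def using insert.prems(1) by (intro is_poly_pairing) auto
  have "finite {t. rk ((\<lambda>i. w i t) ` J) < card J}"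
  proof (rule insert.IH)
    show "is_poly (\<lambda>t. w i t x)" if "i \<in> J" for i x
      unfolding w_def using that insert.prems(1) p_poly
      by (auto simp: fscale_apply intro!: is_poly_intros is_poly_pairing)
    show "supported \<Delta> (w i t)" if "i \<in> J" for i t
      unfolding w_def using insert.prems(2)[of i t] insert.prems(2)[of j t] that by (auto simp: supported_def fscale_apply)
    show "inj_on (\<lambda>i. w i t0) J" using insert.prems(3) w0 by (auto simp: inj_on_def)
    have "(\<lambda>i. w i t0) ` J = ?B" using w0 by (intro image_cong) auto
    then show "fv.independent ((\<lambda>i. w i t0) ` J)" using insert.prems(4) fv.independent_mono by fastforce
  qed
  moreover have "finite {t. p t = 0}" using is_poly_finite_zeros[OF p_poly, of t0] f(2) by (simp add: p_def)
  moreover have "card (insert j J) \<le> rk ((\<lambda>i. v i t) ` insert j J)"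
    if "p t \<noteq> 0" "\<not> rk ((\<lambda>i. w i t) ` J) < card J" for t
  proof -
    let ?W = "(\<lambda>i. w i t) ` J" and ?V = "(\<lambda>i. v i t) ` insert j J"
    have "pairing \<Delta> f (w i t) = 0" for i
      by (simp add: w_def pairing_diff pairing_scale p_def)
    then have "v j t \<notin> fv.span ?W"
      using pairing_zero_on_span[of "v j t" ?W \<Delta> f] that by (auto simp: p_def)
    then have "rk (insert (v j t) ?W) = Suc (rk ?W)"
      using insert.hyps by (simp add: fv.dim_insert_finite)
    moreover have "insert (v j t) ?W \<subseteq> fv.span ?V"
      by (auto simp: w_def intro!: fv.span_diff fv.span_scale intro: fv.span_base)
    then have "rk (insert (v j t) ?W) \<le> rk ?V"
      using insert.hyps by (intro fv.dim_mono_finite) auto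
    ultimately show ?thesis using that insert.hyps by simp
  qed
  then have "{t. rk ((\<lambda>i. v i t) ` insert j J) < card (insert j J)}
      \<subseteq> {t. p t = 0} \<union> {t. rk ((\<lambda>i. w i t) ` J) < card J}"
    by (smt (verit, best) UnI1 UnI2 mem_Collect_eq not_le subsetI)
  ultimately show ?case by (meson finite_UnI finite_subset)
qed

text \<open>Semicontinuity: the maximal rank of a polynomial family is attained outside a finite set of
  parameters.\<close>

lemma cofinite_rank_ge:
  fixes v :: "'i \<Rightarrow> complex \<Rightarrow> 'a \<Rightarrow> complex"
  assumes "finite \<Delta>" "finite I"
    and "\<And>i x. i \<in> I \<Longrightarrow> is_poly (\<lambda>t. v i t x)"
    and "\<And>i t. i \<in> I \<Longrightarrow> supported \<Delta> (v i t)"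
  shows "finite {t. rk ((\<lambda>i. v i t) ` I) < rk ((\<lambda>i. v i t0) ` I)}"
proof -
  obtain B where B: "B \<subseteq> (\<lambda>i. v i t0) ` I" "fv.independent B" "card B = rk ((\<lambda>i. v i t0) ` I)"
    by (rule fv.basis_exists)
  obtain J where J: "J \<subseteq> I" "inj_on (\<lambda>i. v i t0) J" "B = (\<lambda>i. v i t0) ` J"
    using B(1) by (meson subset_image_inj)
  have fJ: "finite J" using J(1) assms(2) finite_subset by blast
  have "finite {t. rk ((\<lambda>i. v i t) ` J) < card J}"
    using assms J B by (intro cofinite_rank_ge_independent[of \<Delta>] fJ) auto
  moreover have "card J = card B" using J card_image by metis
  moreover have "rk ((\<lambda>i. v i t) ` J) \<le> rk ((\<lambda>i. v i t) ` I)" for t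
    using J(1) assms(2) by (intro fv.dim_mono_finite) (auto intro: fv.span_base)
  ultimately have "{t. rk ((\<lambda>i. v i t) ` I) < rk ((\<lambda>i. v i t0) ` I)}
      \<subseteq> {t. rk ((\<lambda>i. v i t) ` J) < card J}"
    using B(3) by (auto intro: le_less_trans)
  then show ?thesis using \<open>finite {t. rk ((\<lambda>i. v i t) ` J) < card J}\<close> by (rule finite_subset)
qed

text \<open>If the \<open>c j\<close> are read as the coefficients of \<open>x ^ (k - j) * y ^ j\<close> in a binary form of degree
  \<open>k\<close>, these equations say that the form is proportional to \<open>(x + \<sigma> y) ^ k\<close>.\<close>

definition power_conditions :: "nat \<Rightarrow> (nat \<Rightarrow> 'a \<Rightarrow> complex) \<Rightarrow> complex \<Rightarrow> ('a \<Rightarrow> complex) set" where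
  "power_conditions k c \<sigma> = (\<lambda>j. c j - fscale (of_nat (k choose j) * \<sigma> ^ j) (c 0)) ` {1..k}"

text \<open>If the \<open>k + 1\<close> coefficients are independent modulo \<open>S\<close>, then \<open>k\<close> equations between them
  are so too.  Otherwise a linear equation between the coefficients follows from the conditions
  \<open>S\<close>, which confines the form to a hyperplane.  The powers of linear forms span all forms, so for
  general \<open>\<sigma>\<close> the power \<open>(x + \<sigma> y) ^ k\<close> is not in this hyperplane, and proportionality to it forces the form to vanish.\<close>

lemma cofinite_power_conditions_rank:
  fixes c :: "nat \<Rightarrow> 'a \<Rightarrow> complex"
  assumes "finite S"
  shows "finite {\<sigma>. rk (S \<union> power_conditions k c \<sigma>) < min (rk (S \<union> c ` {..k})) (rk S + k)}"
proof -
  let ?Z = "power_conditions k c"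
  have fin: "finite (?Z \<sigma>)" for \<sigma> by (simp add: power_conditions_def)
  have c_in: "c j \<in> fv.span (insert (c 0) (S \<union> ?Z \<sigma>))" if "j \<le> k" for j \<sigma>
  proof (cases "j = 0")
    case False
    then have "c j - fscale (of_nat (k choose j) * \<sigma> ^ j) (c 0) \<in> ?Z \<sigma>"
      using that unfolding power_conditions_def by auto
    then show ?thesis unfolding fv.span_breakdown_eq by (blast intro: fv.span_base)
  qed (simp add: fv.span_base)
  have S_in: "S \<subseteq> fv.span (insert (c 0) (S \<union> ?Z \<sigma>))" for \<sigma> by (auto intro: fv.span_base)
  have le: "rk (S \<union> c ` {..k}) \<le> rk (insert (c 0) (S \<union> ?Z \<sigma>))" for \<sigma>
    using c_in S_in assms fin by (intro fv.dim_mono_finite) auto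
  show ?thesis
  proof (cases "\<exists>j\<le>k. c j \<in> fv.span (S \<union> c ` {..<j})")
    case True
    then obtain j \<phi> where j: "j \<le> k" and \<phi>: "c j - (\<Sum>i<j. fscale (\<phi> i) (c i)) \<in> fv.span S"
      using fv.span_Un_image_explicit by blast
    \<comment> \<open>the value at \<open>(x + \<sigma> y) ^ k\<close> of the equation of the hyperplane\<close>
    define P where "P \<sigma> = of_nat (k choose j) * \<sigma> ^ j - (\<Sum>i<j. \<phi> i * (of_nat (k choose i) * \<sigma> ^ i))" for \<sigma> :: complex
    define p where "p = monom (of_nat (k choose j)) j - (\<Sum>i<j. monom (\<phi> i * of_nat (k choose i)) i)"
    have "coeff p j = of_nat (k choose j)"
      by (simp add: p_def coeff_sum)
    then have "p \<noteq> 0" using j by (metis coeff_0 of_nat_eq_0_iff binomial_eq_0_iff not_less)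
    have P: "P \<sigma> = poly p \<sigma>" for \<sigma>
      by (simp add: P_def p_def poly_sum poly_monom algebra_simps)
    have "rk (S \<union> c ` {..k}) \<le> rk (S \<union> ?Z \<sigma>)" if "poly p \<sigma> \<noteq> 0" for \<sigma>
    proof -
      let ?X = "fv.span (S \<union> ?Z \<sigma>)"
      have mod: "c i - fscale (of_nat (k choose i) * \<sigma> ^ i) (c 0) \<in> ?X" if "i \<le> k" for i
      proof (cases "i = 0")
        case False
        then show ?thesis using that by (auto simp: power_conditions_def intro!: fv.span_base)
      qed (simp add: fv.span_zero)
      have 1: "(\<Sum>i<j. fscale (\<phi> i) (c i - fscale (of_nat (k choose i) * \<sigma> ^ i) (c 0))) \<in> ?X"
        using j by (intro fv.span_sum fv.span_scale mod) auto
      have 2: "c j - (\<Sum>i<j. fscale (\<phi> i) (c i)) \<in> ?X"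
        using \<phi> fv.span_mono[of S "S \<union> ?Z \<sigma>"] by blast
      have "fscale (P \<sigma>) (c 0) = (c j - (\<Sum>i<j. fscale (\<phi> i) (c i)))
          - (c j - fscale (of_nat (k choose j) * \<sigma> ^ j) (c 0))
          + (\<Sum>i<j. fscale (\<phi> i) (c i - fscale (of_nat (k choose i) * \<sigma> ^ i) (c 0)))"
        by (simp add: fun_eq_iff sum_fun_apply fscale_apply P_def sum_subtractf sum_distrib_left sum_distrib_right algebra_simps)
      also have "\<dots> \<in> ?X" by (intro fv.span_add fv.span_diff 1 2 mod j)
      finally have "fscale (inverse (P \<sigma>)) (fscale (P \<sigma>) (c 0)) \<in> ?X" by (rule fv.span_scale)
      then have "c 0 \<in> ?X" using that by (simp add: P fv.scale_scale)
      then have "rk (insert (c 0) (S \<union> ?Z \<sigma>)) = rk (S \<union> ?Z \<sigma>)"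
        using assms fin by (simp add: fv.dim_insert_finite)
      then show ?thesis using le[of \<sigma>] by simp
    qed
    then have "{\<sigma>. rk (S \<union> ?Z \<sigma>) < min (rk (S \<union> c ` {..k})) (rk S + k)} \<subseteq> {\<sigma>. poly p \<sigma> = 0}"
      by force
    then show ?thesis using \<open>p \<noteq> 0\<close> poly_roots_finite finite_subset by blast
  next
    case False
    have "rk (S \<union> c ` {..<n}) = rk S + n" if "n \<le> Suc k" for n
      using that
    proof (induction n)
      case (Suc n)
      then show ?case using False assms by (simp add: lessThan_Suc fv.dim_insert_finite)
    qed simp
    from this[of "Suc k"] have "rk (S \<union> c ` {..k}) = rk S + Suc k"
      by (simp add: lessThan_Suc_atMost)
    moreover have "rk (insert (c 0) (S \<union> ?Z \<sigma>)) \<le> Suc (rk (S \<union> ?Z \<sigma>))" for \<sigma>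
      using assms fin by (simp add: fv.dim_insert_finite)
    ultimately have "rk S + k \<le> rk (S \<union> ?Z \<sigma>)" for \<sigma> using le[of \<sigma>] by (metis Suc_le_mono add_Suc_right le_trans)
    then have "{\<sigma>. rk (S \<union> ?Z \<sigma>) < min (rk (S \<union> c ` {..k})) (rk S + k)} = {}"
      by (metis (no_types, lifting) Collect_empty_eq leD min_less_iff_conj)
    then show ?thesis by (simp only: finite.emptyI)
  qed
qed

section \<open>Taylor coefficients of plane polynomials\<close>

definition exps :: "nat \<Rightarrow> (nat \<times> nat) set" where
  "exps d = {(k, l). k + l \<le> d}"

lemma exps_iff [simp]: "(k, l) \<in> exps d \<longleftrightarrow> k + l \<le> d"
  by (simp add: exps_def)

lemma finite_exps [simp]: "finite (exps d)"
proof (rule finite_subset)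
  show "exps d \<subseteq> {..d} \<times> {..d}" by (auto simp: exps_def)
qed simp

text \<open>The functional that takes a polynomial to the coefficient with exponents \<open>e\<close> in its
  expansion at the point \<open>p\<close>.\<close>

definition taylor :: "complex \<times> complex \<Rightarrow> nat \<times> nat \<Rightarrow> nat \<times> nat \<Rightarrow> complex" where
  "taylor p e = (\<lambda>(k, l). of_nat (k choose fst e) * of_nat (l choose snd e)
      * fst p ^ (k - fst e) * snd p ^ (l - snd e))"

text \<open>The target ring varies so that the expansion applies both to values and, with polynomials
  for \<open>U\<close> and \<open>W\<close>, to substitutions.\<close>

lemma taylor_expand:
  fixes \<kappa> :: "complex \<Rightarrow> 'r::comm_ring_1"
  assumes \<kappa>: "\<And>x y. \<kappa> (x + y) = \<kappa> x + \<kappa> y" "\<And>x y. \<kappa> (x * y) = \<kappa> x * \<kappa> y" "\<kappa> 1 = 1"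
    and D: "k + l \<le> D"
  shows "(\<kappa> (fst p) + U) ^ k * (\<kappa> (snd p) + W) ^ l
    = (\<Sum>e\<in>exps D. \<kappa> (taylor p e (k, l)) * (U ^ fst e * W ^ snd e))"
proof -
  have \<kappa>0: "\<kappa> 0 = 0" using \<kappa>(1)[of 0 0] by simp
  have \<kappa>_nat: "\<kappa> (of_nat n) = of_nat n" for n by (induction n) (simp_all add: \<kappa> \<kappa>0)
  have \<kappa>_pow: "\<kappa> (x ^ n) = \<kappa> x ^ n" for x n by (induction n) (simp_all add: \<kappa>)
  have "(\<Sum>e\<in>exps D. \<kappa> (taylor p e (k, l)) * (U ^ fst e * W ^ snd e))
      = (\<Sum>e\<in>{..k} \<times> {..l}. \<kappa> (taylor p e (k, l)) * (U ^ fst e * W ^ snd e))"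
  proof (rule sum.mono_neutral_right)
    show "finite (exps D)" by simp
    show "{..k} \<times> {..l} \<subseteq> exps D" using D by auto
    show "\<forall>e\<in>exps D - {..k} \<times> {..l}. \<kappa> (taylor p e (k, l)) * (U ^ fst e * W ^ snd e) = 0"
    proof
      fix e assume e: "e \<in> exps D - {..k} \<times> {..l}"
      obtain i j where ij: "e = (i, j)" by (cases e)
      with e have "k < i \<or> l < j" by auto
      then have "taylor p e (k, l) = 0" by (auto simp: taylor_def ij binomial_eq_0)
      then show "\<kappa> (taylor p e (k, l)) * (U ^ fst e * W ^ snd e) = 0" by (simp add: \<kappa>0)
    qed
  qed
  also have "\<dots> = (\<Sum>i\<le>k. \<Sum>j\<le>l. \<kappa> (taylor p (i, j) (k, l)) * (U ^ i * W ^ j))"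
    by (simp add: sum.cartesian_product case_prod_beta)
  also have "\<dots> = (\<Sum>i\<le>k. of_nat (k choose i) * U ^ i * \<kappa> (fst p) ^ (k - i))
      * (\<Sum>j\<le>l. of_nat (l choose j) * W ^ j * \<kappa> (snd p) ^ (l - j))"
    unfolding sum_product by (simp add: taylor_def \<kappa> \<kappa>_nat \<kappa>_pow mult_ac)
  also have "\<dots> = (U + \<kappa> (fst p)) ^ k * (W + \<kappa> (snd p)) ^ l"
    by (simp add: binomial_ring)
  finally show ?thesis by (simp add: add.commute)
qed

lemma subst_taylor_expand:
  fixes \<kappa> :: "complex \<Rightarrow> 'r::comm_ring_1"
  assumes \<kappa>: "\<And>x y. \<kappa> (x + y) = \<kappa> x + \<kappa> y" "\<And>x y. \<kappa> (x * y) = \<kappa> x * \<kappa> y" "\<kappa> 1 = 1"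
  shows "(\<Sum>z\<in>exps d. \<kappa> (f z) * ((\<kappa> (fst p) + U) ^ fst z * (\<kappa> (snd p) + W) ^ snd z))
    = (\<Sum>e\<in>exps d. \<kappa> (pairing (exps d) f (taylor p e)) * (U ^ fst e * W ^ snd e))"
proof -
  have \<kappa>0: "\<kappa> 0 = 0" using \<kappa>(1)[of 0 0] by simp
  have \<kappa>_sum: "\<kappa> (sum g A) = (\<Sum>x\<in>A. \<kappa> (g x))" for g and A :: "(nat \<times> nat) set"
    by (induction A rule: infinite_finite_induct) (simp_all add: \<kappa> \<kappa>0)
  have "(\<Sum>z\<in>exps d. \<kappa> (f z) * ((\<kappa> (fst p) + U) ^ fst z * (\<kappa> (snd p) + W) ^ snd z))
    = (\<Sum>z\<in>exps d. \<kappa> (f z) * (\<Sum>e\<in>exps d. \<kappa> (taylor p e z) * (U ^ fst e * W ^ snd e)))"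
    using taylor_expand[of \<kappa>, OF \<kappa>] by (intro sum.cong refl arg_cong2[of _ _ _ _ "(*)"]) (auto simp: exps_def)
  also have "\<dots> = (\<Sum>e\<in>exps d. \<Sum>z\<in>exps d. \<kappa> (f z * taylor p e z) * (U ^ fst e * W ^ snd e))"
    unfolding sum_distrib_left by (subst sum.swap) (simp add: \<kappa> mult_ac)
  finally show ?thesis
    unfolding pairing_def \<kappa>_sum sum_distrib_right .
qed

section \<open>Curves of degree 3m through nine m-fold points of a cuspidal cubic\<close>

abbreviation cst :: "complex \<Rightarrow> complex poly poly" where "cst c \<equiv> [:[:c:]:]"

abbreviation varX :: "complex poly poly" where "varX \<equiv> [:[:0, 1:]:]"

abbreviation varY :: "complex poly poly" where "varY \<equiv> [:0, 1:]"

text \<open>The bound on the total degree is strict so that \<open>deg_less 0\<close> characterises the zero polynomial,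
  as is needed for the remainder after removal of a leading form of degree \<open>0\<close>.\<close>

definition deg_less :: "nat \<Rightarrow> complex poly poly \<Rightarrow> bool" where
  "deg_less n f \<longleftrightarrow> (\<forall>i j. n \<le> i + j \<longrightarrow> coeff (coeff f j) i = 0)"

lemma deg_less_add: "deg_less n f \<Longrightarrow> deg_less n g \<Longrightarrow> deg_less n (f + g)"
  and deg_less_diff: "deg_less n f \<Longrightarrow> deg_less n g \<Longrightarrow> deg_less n (f - g)"
  and deg_less_0: "deg_less n 0"
  and deg_less_mono: "deg_less n f \<Longrightarrow> n \<le> n' \<Longrightarrow> deg_less n' f"
  by (auto simp: deg_less_def)

lemma deg_less_sum: "(\<And>x. x \<in> A \<Longrightarrow> deg_less n (g x)) \<Longrightarrow> deg_less n (sum g A)"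
  by (induction A rule: infinite_finite_induct) (auto intro: deg_less_0 deg_less_add)

lemma deg_less_mult:
  assumes f: "deg_less (Suc d) f" and g: "deg_less n g"
  shows "deg_less (d + n) (f * g)"
  unfolding deg_less_def
proof (intro allI impI)
  fix i j assume ij: "d + n \<le> i + j"
  have *: "coeff (coeff f b) a * coeff (coeff g (j - b)) (i - a) = 0" if "b \<le> j" "a \<le> i" for a b
  proof (cases "Suc d \<le> a + b")
    case True
    then show ?thesis using f by (simp add: deg_less_def)
  next
    case False
    then have "n \<le> (i - a) + (j - b)" using ij that by linarith
    then show ?thesis using g by (simp add: deg_less_def)
  qed
  show "coeff (coeff (f * g) j) i = 0"
    unfolding coeff_mult coeff_sum by (intro sum.neutral ballI *) auto
qed

lemma deg_less_cst: "deg_less (Suc 0) (cst c)"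
  by (auto simp: deg_less_def coeff_pCons split: nat.splits)

lemma deg_less_power: "deg_less (Suc d) f \<Longrightarrow> deg_less (Suc (n * d)) (f ^ n)"
proof (induction n)
  case 0
  show ?case using deg_less_cst[of 1] by (simp add: one_pCons)
next
  case (Suc n)
  then show ?case using deg_less_mult[of d f "Suc (n * d)" "f ^ n"] by simp
qed

lemma deg_less_linear: "deg_less 2 (varX + cst s * varY)" "deg_less 2 varY"
  by (auto simp: deg_less_def coeff_pCons split: nat.splits)

definition cubic :: "complex poly poly" where "cubic = [:- monom 1 3, 1:]"

lemma cubic_eq: "cubic = varY - varX ^ 3"
  by (simp add: cubic_def monom_altdef poly_const_pow)

text \<open>Membership in the \<open>n\<close>-th power of the ideal \<open>(x - a, z)\<close>.  With \<open>z = y - x ^ 3\<close> as second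
  coordinate, this expresses multiplicity at least \<open>n\<close> at the point \<open>(a, a ^ 3)\<close>; division by the
  cubic then becomes division by \<open>z\<close> and visibly lowers the multiplicity by one.\<close>

definition adic :: "complex \<Rightarrow> nat \<Rightarrow> complex poly poly \<Rightarrow> bool" where
  "adic a n h \<longleftrightarrow> (\<forall>r. [:- a, 1:] ^ (n - r) dvd coeff h r)"

lemma adic_0: "adic a n 0" by (simp add: adic_def)

lemma adic_add: "adic a n g \<Longrightarrow> adic a n h \<Longrightarrow> adic a n (g + h)"
  by (simp add: adic_def)

lemma adic_mult:
  assumes "adic a n g" "adic a n' h"
  shows "adic a (n + n') (g * h)"
  unfolding adic_def
proof
  fix r
  have "[:- a, 1:] ^ (n + n' - r) dvd coeff g s * coeff h (r - s)" if "s \<le> r" for s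
  proof -
    have "[:- a, 1:] ^ (n + n' - r) dvd [:- a, 1:] ^ ((n - s) + (n' - (r - s)))"
      using that by (intro le_imp_power_dvd) linarith
    also have "\<dots> dvd coeff g s * coeff h (r - s)"
      unfolding power_add using assms by (intro mult_dvd_mono) (auto simp: adic_def)
    finally show ?thesis .
  qed
  then show "[:- a, 1:] ^ (n + n' - r) dvd coeff (g * h) r"
    unfolding coeff_mult by (intro dvd_sum) auto
qed

lemma adic_mono: "adic a n h \<Longrightarrow> n' \<le> n \<Longrightarrow> adic a n' h"
  unfolding adic_def by (meson diff_le_mono dvd_trans le_imp_power_dvd)

lemma adic_zero: "adic a 0 h" by (simp add: adic_def)

lemma adic_power: "adic a 1 h \<Longrightarrow> adic a n (h ^ n)"
proof (induction n)
  case (Suc n)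
  then show ?case using adic_mult[of a 1 h n "h ^ n"] by simp
qed (simp add: adic_zero)

lemma adic_sum: "(\<And>x. x \<in> A \<Longrightarrow> adic a n (g x)) \<Longrightarrow> adic a n (sum g A)"
  by (induction A rule: infinite_finite_induct) (auto intro: adic_0 adic_add)

lemma prod_linear_factors_coeffs:
  fixes rs :: "complex list"
  shows "degree (\<Prod>r\<leftarrow>rs. [:- r, 1:]) = length rs"
    and "coeff (\<Prod>r\<leftarrow>rs. [:- r, 1:]) (length rs) = 1"
    and "rs \<noteq> [] \<Longrightarrow> coeff (\<Prod>r\<leftarrow>rs. [:- r, 1:]) (length rs - 1) = - sum_list rs"
proof -
  let ?P = "\<lambda>rs :: complex list. \<Prod>r\<leftarrow>rs. [:- r, 1:]"
  have 1: "?P rs \<noteq> 0 \<and> degree (?P rs) = length rs" for rs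
  proof (induction rs)
    case (Cons r rs)
    then show ?case by (simp add: degree_mult_eq del: mult_pCons_left)
  qed simp
  have 2: "coeff (?P rs) (length rs) = 1" for rs
  proof (induction rs)
    case (Cons r rs)
    then show ?case using 1[of rs] by (simp add: coeff_eq_0)
  qed simp
  have 3: "rs \<noteq> [] \<longrightarrow> coeff (?P rs) (length rs - 1) = - sum_list rs" for rs
  proof (induction rs)
    case (Cons r rs)
    show ?case
    proof (cases rs)
      case (Cons r' rs')
      have "coeff (?P (r # rs)) (Suc n) = - r * coeff (?P rs) (Suc n) + coeff (?P rs) n" for n
        by simp
      from this[of "length rs'"] show ?thesis using Cons.IH 2[of rs] by (simp add: Cons del: mult_pCons_left)
    qed simp
  qed simp
  show "degree (?P rs) = length rs" "coeff (?P rs) (length rs) = 1"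
    "rs \<noteq> [] \<Longrightarrow> coeff (?P rs) (length rs - 1) = - sum_list rs"
    using 1 2 3 by blast+
qed

lemma prod_power_dvd:
  fixes R :: "complex poly"
  assumes "finite A" "inj_on a A" "\<And>l. l \<in> A \<Longrightarrow> [:- a l, 1:] ^ M dvd R"
  shows "(\<Prod>l\<in>A. [:- a l, 1:] ^ M) dvd R"
  using assms
proof (induction A)
  case (insert l A)
  let ?Q = "\<Prod>l\<in>A. [:- a l, 1:] ^ M"
  obtain s where s: "R = ?Q * s" using insert by (auto elim!: dvdE)
  show ?case
  proof (cases "R = 0")
    case False
    have "poly ?Q (a l) \<noteq> 0"
      using insert by (auto simp: poly_prod poly_power)
    then have "order (a l) R = order (a l) s"
      using s False by (simp add: order_mult order_0I)
    moreover have "M \<le> order (a l) R"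
      using insert.prems False order_divides by blast
    ultimately have "[:- a l, 1:] ^ M dvd s" by (simp add: order_divides)
    then have "?Q * [:- a l, 1:] ^ M dvd R" unfolding s by (intro mult_dvd_mono) auto
    then show ?thesis using insert.hyps by (simp add: mult.commute)
  qed simp
qed simp

lemma poly_at_cube_coeff:
  "coeff (poly f (monom 1 3)) n = (\<Sum>j\<le>degree f. if n < 3 * j then 0 else coeff (coeff f j) (n - 3 * j))"
  for f :: "complex poly poly"
proof -
  have "poly f (monom 1 3) = (\<Sum>j\<le>degree f. monom 1 (3 * j) * coeff f j)"
    by (simp add: poly_altdef monom_power mult.commute)
  then show ?thesis by (simp add: coeff_sum coeff_monom_mult cong: if_cong)
qed

text \<open>On the cuspidal cubic, \<open>x ^ i * y ^ j\<close> becomes \<open>x ^ (i + 3 j)\<close>, so a polynomial of degree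
  \<open>3 M\<close> restricts to one of degree at most \<open>9 M\<close> without a term of degree \<open>9 M - 1\<close>: the cusp
  creates a gap.  Zeros of multiplicity \<open>M\<close> at \<open>0, \<dots>, 8\<close> determine the restriction up to a
  factor, and its coefficient of degree \<open>9 M - 1\<close> is \<open>- 36 M\<close> times that factor.  In terms of the
  additive group of the cubic, the sum of the nine points is not a torsion point.\<close>

lemma vanish_on_cubic:
  assumes deg: "deg_less (Suc (3 * M)) f" and "M \<ge> 1"
    and dvd: "\<And>l. l < 9 \<Longrightarrow> [:- of_nat l, 1:] ^ M dvd poly f (monom 1 3)"
  shows "poly f (monom 1 3) = 0"
proof (rule ccontr)
  let ?R = "poly f (monom 1 3)"
  assume R: "?R \<noteq> 0"
  define rs where "rs = concat (map (\<lambda>l. replicate M (of_nat l :: complex)) [0..<9])"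
  have len: "length rs = 9 * M" by (simp add: rs_def upt_rec)
  have sum: "sum_list rs = of_nat (36 * M)"
    by (simp add: rs_def upt_rec sum_list_replicate)
  have "(\<Prod>r\<leftarrow>rs. [:- r, 1:]) = (\<Prod>l\<leftarrow>[0..<9]. [:- of_nat l, 1:] ^ M)"
    by (simp add: rs_def upt_rec prod_list_replicate mult_ac)
  also have "\<dots> = (\<Prod>l\<in>{..<9}. [:- of_nat l, 1:] ^ M)"
    by (simp add: prod.list_conv_set_nth atLeast0LessThan)
  also have "\<dots> dvd ?R" using dvd by (intro prod_power_dvd) (auto simp: inj_on_def)
  finally obtain q where q: "?R = (\<Prod>r\<leftarrow>rs. [:- r, 1:]) * q" by (elim dvdE)
  have zero: "coeff ?R n = 0" if "n > 9 * M \<or> n = 9 * M - 1" for n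
    unfolding poly_at_cube_coeff
  proof (intro sum.neutral ballI)
    fix j
    have "3 * M < n - 3 * j + j" if "3 * j \<le> n"
    proof -
      define i where "i = n - 3 * j"
      have "n = 3 * j + i" using that by (simp add: i_def)
      then have ge: "9 * M \<le> 3 * j + i + 1" and neq: "3 * j + i \<noteq> 9 * M"
        using \<open>n > 9 * M \<or> n = 9 * M - 1\<close> assms(2) by linarith+
      have "3 * M < i + j"
      proof (rule ccontr)
        assume "\<not> 3 * M < i + j"
        moreover from this have "3 * M \<le> j" using ge by linarith
        ultimately show False using neq by linarith
      qed
      then show ?thesis by (simp add: i_def)
    qed
    then show "(if n < 3 * j then 0 else coeff (coeff f j) (n - 3 * j)) = 0"
      using deg unfolding deg_less_def by (simp add: Suc_le_eq)
  qed
  have "degree ?R \<le> 9 * M" using zero by (intro degree_le) auto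
  moreover have "q \<noteq> 0" "(\<Prod>r\<leftarrow>rs. [:- r, 1:]) \<noteq> 0" using R q by auto
  then have "degree ?R = 9 * M + degree q"
    unfolding q using prod_linear_factors_coeffs(1)[of rs] len by (simp add: degree_mult_eq)
  ultimately have "degree q = 0" by simp
  then obtain c where c: "q = [:c:]" by (rule degree_eq_zeroE)
  have "rs \<noteq> []" using len assms(2) by auto
  then have "coeff ?R (9 * M - 1) = - c * of_nat (36 * M)"
    unfolding q c using prod_linear_factors_coeffs(3)[of rs] len sum by simp
  then have "c = 0" using zero[of "9 * M - 1"] assms(2) by simp
  then show False using R q c by simp
qed

text \<open>Comparing coefficients of powers of \<open>y\<close> from below gives
  \<open>x ^ 3 * g j = g (j - 1) - f j\<close>, which bounds the degrees one after the other.\<close>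

lemma cofactor_deg_less:
  assumes deg: "deg_less (Suc (3 * Suc m)) f" and f: "f = cubic * g"
  shows "deg_less (Suc (3 * m)) g"
proof -
  have rec: "coeff (coeff g j) i = (case j of 0 \<Rightarrow> 0 | Suc j' \<Rightarrow> coeff (coeff g j') (i + 3)) - coeff (coeff f j) (i + 3)" for i j
    by (cases j) (simp_all add: f cubic_def coeff_monom_mult)
  have "coeff (coeff g j) i = 0" if "Suc (3 * m) \<le> i + j" for i j
    using that
  proof (induction j arbitrary: i)
    case 0
    then show ?case using deg by (subst rec) (simp add: deg_less_def)
  next
    case (Suc j)
    then show ?case using deg by (subst rec) (simp add: deg_less_def)
  qed
  then show ?thesis by (simp add: deg_less_def)
qed

text \<open>The curve contains the cubic, and removing the cubic lowers the degree by three and the nine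
  multiplicities by one.\<close>

lemma multiple_of_cubic_power:
  assumes "deg_less (Suc (3 * m)) f"
    and "\<And>l. l < 9 \<Longrightarrow> adic (of_nat l) m (pcompose f [:monom 1 3, 1:])"
  shows "\<exists>c. f = cst c * cubic ^ m"
  using assms
proof (induction m arbitrary: f)
  case 0
  define c where "c = coeff (coeff f 0) 0"
  have "coeff (coeff f j) i = coeff (coeff (cst c) j) i" for i j
  proof (cases "i = 0 \<and> j = 0")
    case False
    then have "coeff (coeff f j) i = 0" using 0(1) by (auto simp: deg_less_def)
    then show ?thesis using False by (auto simp: coeff_pCons split: nat.splits)
  qed (simp add: c_def)
  then have "f = cst c" by (intro poly_eqI)
  then show ?case by auto
next
  case (Suc m)
  have "poly f (monom 1 3) = 0"
  proof (rule vanish_on_cubic[OF Suc.prems(1)])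
    fix l :: nat assume "l < 9"
    from Suc.prems(2)[OF this] show "[:- of_nat l, 1:] ^ Suc m dvd poly f (monom 1 3)"
      unfolding adic_def by (auto dest: spec[of _ 0])
  qed simp
  then obtain g where g: "f = cubic * g" by (auto simp: poly_eq_0_iff_dvd cubic_def elim!: dvdE)
  have "pcompose cubic [:monom 1 3, 1:] = [:0, 1:]"
    by (simp add: cubic_def pcompose_pCons)
  then have comp: "pcompose f [:monom 1 3, 1:] = [:0, 1:] * pcompose g [:monom 1 3, 1:]"
    unfolding g pcompose_mult by simp
  have "\<exists>c. g = cst c * cubic ^ m"
  proof (rule Suc.IH)
    show "deg_less (Suc (3 * m)) g" using cofactor_deg_less Suc.prems(1) g .
    fix l :: nat assume "l < 9"
    from Suc.prems(2)[OF this, unfolded comp adic_def, rule_format, of "Suc r" for r]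
    show "adic (of_nat l) m (pcompose g [:monom 1 3, 1:])" by (simp add: adic_def)
  qed
  then show ?case using g by (auto simp: mult_ac)
qed

definition eval2 :: "complex poly poly \<Rightarrow> complex \<Rightarrow> complex \<Rightarrow> complex" where
  "eval2 f x y = poly (poly f [:y:]) x"

lemma eval2_simps [simp]:
  "eval2 (f + g) x y = eval2 f x y + eval2 g x y"
  "eval2 (f - g) x y = eval2 f x y - eval2 g x y"
  "eval2 (f * g) x y = eval2 f x y * eval2 g x y"
  "eval2 (f ^ n) x y = eval2 f x y ^ n"
  "eval2 (cst c) x y = c" "eval2 varX x y = x" "eval2 varY x y = y"
  by (simp_all add: eval2_def)

lemma eval2_sum: "eval2 (sum g A) x y = (\<Sum>i\<in>A. eval2 (g i) x y)"
  by (simp add: eval2_def poly_sum)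

lemma eval2_inject:
  assumes "\<And>x y. eval2 f x y = eval2 g x y"
  shows "f = g"
proof (rule ccontr)
  assume "f \<noteq> g"
  then have "finite {z. poly (f - g) z = 0}" by (intro poly_roots_finite) simp
  moreover have "poly (f - g) [:y:] = 0" for y
  proof -
    have "poly (poly (f - g) [:y:]) x = 0" for x using assms[of x y] by (simp add: eval2_def)
    then show ?thesis using poly_all_0_iff_0 by blast
  qed
  then have "range (\<lambda>y. [:y:]) \<subseteq> {z. poly (f - g) z = 0}" by auto
  moreover have "infinite (range (\<lambda>y :: complex. [:y:]))"
    by (subst finite_image_iff) (auto simp: inj_on_def infinite_UNIV_char_0)
  ultimately show False using finite_subset by blast
qed

text \<open>The images of the nine points \<open>(l, l ^ 3)\<close> of the cubic under the shear that takes
  \<open>(x, y)\<close> to \<open>(x - \<sigma> y, y)\<close>.\<close>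

definition nine_points :: "complex \<Rightarrow> nat \<Rightarrow> complex \<times> complex" where
  "nine_points \<sigma> l = (of_nat l - \<sigma> * of_nat l ^ 3, of_nat l ^ 3)"

text \<open>The shear is there to give the cubic through the nine points the leading form
  \<open>(x + \<sigma> y) ^ 3\<close>, up to sign, for an arbitrary \<open>\<sigma>\<close>.\<close>

definition sheared_cubic :: "complex \<Rightarrow> complex poly poly" where
  "sheared_cubic \<sigma> = varY - (varX + cst \<sigma> * varY) ^ 3"

lemma cst_mult: "cst (x * y) = cst x * cst y" and cst_add: "cst (x + y) = cst x + cst y"
  and cst_1: "cst 1 = 1"
  by (simp_all add: one_pCons)

lemma pcompose_pow: "pcompose (p ^ n) q = pcompose p q ^ n" for p q :: "complex poly poly"
  by (induction n) (simp_all add: pcompose_mult pcompose_1)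

lemma cst_vars_monom: "cst c * (varX ^ i * varY ^ j) = monom (monom c i) j"
  by (simp add: poly_const_pow monom_altdef smult_monom)

lemma coeff_subst_vars:
  "coeff (coeff (\<Sum>z\<in>exps d. cst (f z) * (varX ^ fst z * varY ^ snd z)) l) k
    = (if (k, l) \<in> exps d then f (k, l) else 0)"
proof -
  have "coeff (coeff (\<Sum>z\<in>exps d. cst (f z) * (varX ^ fst z * varY ^ snd z)) l) k
    = (\<Sum>z\<in>exps d. if z = (k, l) then f z else 0)"
    unfolding coeff_sum cst_vars_monom by (intro sum.cong) auto
  then show ?thesis by (simp add: sum.delta)
qed

text \<open>Undoing the shear reduces this to \<open>multiple_of_cubic_power\<close>: at \<open>(a, a ^ 3)\<close> the sheared
  local coordinates lie in the ideal \<open>(x - a, z)\<close>, so the Taylor expansion of order \<open>m\<close> lies in its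
  \<open>m\<close>-th power.\<close>

lemma polys_vanishing_on_nine_points:
  assumes "\<And>l i j. l < 9 \<Longrightarrow> i + j < m \<Longrightarrow>
      pairing (exps (3 * m)) f (taylor (nine_points \<sigma> l) (i, j)) = 0"
  shows "\<exists>c. \<forall>k l. k + l \<le> 3 * m \<longrightarrow> f (k, l) = c * coeff (coeff (sheared_cubic \<sigma> ^ m) l) k"
proof -
  define D where "D = exps (3 * m)"
  define A where "A = varX + cst (- \<sigma>) * varY"
  define f' where "f' = (\<Sum>z\<in>D. cst (f z) * (A ^ fst z * varY ^ snd z))"
  define q where "q = [:monom 1 3 :: complex poly, 1:]"
  have deg: "deg_less (Suc (3 * m)) f'"
    unfolding f'_def
  proof (rule deg_less_sum)
    fix z assume z: "z \<in> D"
    have "deg_less (Suc (fst z)) (A ^ fst z)" "deg_less (Suc (snd z)) (varY ^ snd z)"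
      using deg_less_power[of 1 A "fst z"] deg_less_power[of 1 varY "snd z"] deg_less_linear
      by (simp_all add: A_def numeral_2_eq_2)
    then have "deg_less (0 + (fst z + Suc (snd z))) (cst (f z) * (A ^ fst z * varY ^ snd z))"
      by (intro deg_less_mult) (use deg_less_cst in auto)
    then show "deg_less (Suc (3 * m)) (cst (f z) * (A ^ fst z * varY ^ snd z))"
      by (rule deg_less_mono) (use z in \<open>auto simp: D_def exps_def\<close>)
  qed
  have "\<exists>c. f' = cst c * cubic ^ m"
  proof (rule multiple_of_cubic_power[OF deg])
    fix l :: nat assume l: "l < 9"
    define a where "a = (of_nat l :: complex)"
    define W where "W = [:monom 1 3 - [:a ^ 3:], 1:]"
    define U where "U = [:[:- a, 1:]:] + cst (- \<sigma>) * W"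
    have W: "adic a 1 W"
      by (auto simp: adic_def W_def coeff_pCons poly_eq_0_iff_dvd[symmetric] poly_monom split: nat.splits)
    have "adic a (0 + 1) (cst (- \<sigma>) * W)" by (intro adic_mult W adic_zero)
    moreover have "adic a 1 [:[:- a, 1:]:]" by (auto simp: adic_def coeff_pCons split: nat.splits)
    ultimately have U: "adic a 1 U" unfolding U_def by (intro adic_add) auto
    have Aq: "pcompose A q = cst (fst (nine_points \<sigma> l)) + U"
      by (simp add: A_def q_def U_def W_def nine_points_def a_def pcompose_add pcompose_mult pcompose_pCons algebra_simps)
    have Yq: "pcompose varY q = cst (snd (nine_points \<sigma> l)) + W"
      by (simp add: q_def W_def nine_points_def a_def pcompose_pCons)
    have "pcompose f' q = (\<Sum>z\<in>D. cst (f z) * (pcompose A q ^ fst z * pcompose varY q ^ snd z))"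
      by (simp add: f'_def pcompose_sum pcompose_mult pcompose_pow del: mult_pCons_left)
    also have "\<dots> = (\<Sum>e\<in>D. cst (pairing D f (taylor (nine_points \<sigma> l) e)) * (U ^ fst e * W ^ snd e))"
      unfolding Aq Yq D_def by (rule subst_taylor_expand[OF cst_add cst_mult cst_1])
    finally have eq: "pcompose f' q = \<dots>" .
    show "adic (of_nat l) m (pcompose f' [:monom 1 3, 1:])"
      unfolding eq[unfolded q_def] a_def[symmetric]
    proof (rule adic_sum)
      fix e assume "e \<in> D"
      show "adic a m (cst (pairing D f (taylor (nine_points \<sigma> l) e)) * (U ^ fst e * W ^ snd e))"
      proof (cases "fst e + snd e < m")
        case True
        then have "pairing D f (taylor (nine_points \<sigma> l) e) = 0"
          using assms[OF l, of "fst e" "snd e"] by (simp add: D_def)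
        then show ?thesis by (simp add: adic_0)
      next
        case False
        have "adic a (0 + (fst e + snd e)) (cst (pairing D f (taylor (nine_points \<sigma> l) e)) * (U ^ fst e * W ^ snd e))"
          by (intro adic_mult adic_zero adic_power U W)
        then show ?thesis by (rule adic_mono) (use False in simp)
      qed
    qed
  qed
  then obtain c where c: "f' = cst c * cubic ^ m" by blast
  have "(\<Sum>z\<in>D. cst (f z) * (varX ^ fst z * varY ^ snd z)) = cst c * sheared_cubic \<sigma> ^ m"
  proof (rule eval2_inject)
    fix x y
    have "eval2 (\<Sum>z\<in>D. cst (f z) * (varX ^ fst z * varY ^ snd z)) x y = eval2 f' (x + \<sigma> * y) y"
      by (simp add: f'_def A_def eval2_sum del: mult_pCons_left mult_pCons_right)
    also have "\<dots> = eval2 (cst c * sheared_cubic \<sigma> ^ m) x y"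
      unfolding c cubic_eq sheared_cubic_def by (simp del: mult_pCons_left mult_pCons_right)
    finally show "eval2 (\<Sum>z\<in>D. cst (f z) * (varX ^ fst z * varY ^ snd z)) x y = \<dots>" .
  qed
  then have "coeff (coeff (\<Sum>z\<in>D. cst (f z) * (varX ^ fst z * varY ^ snd z)) l) k
      = c * coeff (coeff (sheared_cubic \<sigma> ^ m) l) k" for k l
    by simp
  then show ?thesis unfolding D_def coeff_subst_vars by (metis exps_iff)
qed

text \<open>Modulo terms of lower degree, the power of the sheared cubic is
  \<open>(- 1) ^ m * (x + \<sigma> y) ^ (3 m)\<close>.\<close>

lemma sheared_cubic_power_top:
  assumes "j \<le> 3 * m"
  shows "coeff (coeff (sheared_cubic \<sigma> ^ m) j) (3 * m - j) = (- 1) ^ m * of_nat (3 * m choose j) * \<sigma> ^ j"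
proof -
  let ?H = "varX + cst \<sigma> * varY"
  have H: "deg_less 2 ?H" by (rule deg_less_linear)
  have H3: "deg_less (Suc 3) (?H ^ 3)" using deg_less_power[of 1 ?H 3] H by (simp add: numeral_2_eq_2)
  have cubic: "deg_less (Suc 3) (sheared_cubic \<sigma>)"
    unfolding sheared_cubic_def by (intro deg_less_diff H3 deg_less_mono[OF deg_less_linear(2)]) simp
  have "deg_less (3 * m) (sheared_cubic \<sigma> ^ m - cst ((- 1) ^ m) * ?H ^ (3 * m))"
  proof (induction m)
    case 0
    then show ?case using deg_less_0 by (simp add: one_pCons)
  next
    case (Suc m)
    let ?g = "sheared_cubic \<sigma> ^ m"
    have "deg_less (Suc (3 * m)) ?g" using deg_less_power[OF cubic, of m] by (simp add: mult.commute)
    then have "deg_less (3 * m + 2) (?g * varY)" by (intro deg_less_mult deg_less_linear)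
    then have 1: "deg_less (3 + 3 * m) (?g * varY)" by (rule deg_less_mono) simp
    have 2: "deg_less (3 + 3 * m) (?H ^ 3 * (?g - cst ((- 1) ^ m) * ?H ^ (3 * m)))"
      by (rule deg_less_mult[OF H3 Suc.IH])
    have ring: "g * (V - K) - (- C) * (K * L) = g * V - K * (g - C * L)" for g V K C L :: "complex poly poly"
      by (simp add: algebra_simps)
    have "sheared_cubic \<sigma> ^ Suc m = ?g * (varY - ?H ^ 3)"
      unfolding power_Suc2 by (simp only: sheared_cubic_def)
    moreover have "cst ((- 1) ^ Suc m) = - cst ((- 1) ^ m)" by simp
    moreover have "?H ^ (3 * Suc m) = ?H ^ 3 * ?H ^ (3 * m)" by (simp only: power_add[symmetric] mult_Suc_right)
    ultimately
    have "sheared_cubic \<sigma> ^ Suc m - cst ((- 1) ^ Suc m) * ?H ^ (3 * Suc m)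
      = ?g * varY - ?H ^ 3 * (?g - cst ((- 1) ^ m) * ?H ^ (3 * m))"
      by (simp only: ring)
    then show ?case using deg_less_diff[OF 1 2] by simp
  qed
  then have "coeff (coeff (sheared_cubic \<sigma> ^ m - cst ((- 1) ^ m) * ?H ^ (3 * m)) j) (3 * m - j) = 0"
    using assms by (simp add: deg_less_def)
  then have "coeff (coeff (sheared_cubic \<sigma> ^ m) j) (3 * m - j) = (- 1) ^ m * coeff (coeff (?H ^ (3 * m)) j) (3 * m - j)"
    by simp
  also have "coeff (coeff (?H ^ (3 * m)) j) (3 * m - j) = of_nat (3 * m choose j) * \<sigma> ^ j"
  proof -
    have "?H = [:[:0, 1:], [:\<sigma>:]:]" by simp
    then have "coeff (?H ^ (3 * m)) j = of_nat (3 * m choose j) * [:\<sigma>:] ^ j * [:0, 1:] ^ (3 * m - j)"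
      using coeff_linear_poly_power[OF assms] by metis
    also have "\<dots> = monom (of_nat (3 * m choose j) * \<sigma> ^ j) (3 * m - j)"
      by (simp add: poly_const_pow monom_altdef of_nat_poly mult.commute)
    finally show ?thesis by simp
  qed
  finally show ?thesis by simp
qed

definition trunc :: "'a set \<Rightarrow> ('a \<Rightarrow> complex) \<Rightarrow> 'a \<Rightarrow> complex" where
  "trunc D v = (\<lambda>z. if z \<in> D then v z else 0)"

lemma supported_trunc: "supported D (trunc D v)"
  by (simp add: supported_def trunc_def)

lemma pairing_trunc: "pairing D f (trunc D v) = pairing D f v"
  by (simp add: pairing_def trunc_def)

lemma span_image_linear:
  fixes h :: "('a \<Rightarrow> complex) \<Rightarrow> 'b \<Rightarrow> complex"
  assumes "\<And>v w. h (v + w) = h v + h w" "\<And>c v. h (fscale c v) = fscale c (h v)"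
  shows "fv.span (h ` S) = h ` fv.span S"
proof -
  interpret pr: vector_space_pair "fscale :: complex \<Rightarrow> ('a \<Rightarrow> complex) \<Rightarrow> 'a \<Rightarrow> complex"
    "fscale :: complex \<Rightarrow> ('b \<Rightarrow> complex) \<Rightarrow> 'b \<Rightarrow> complex" ..
  have "Vector_Spaces.linear fscale fscale h" by unfold_locales (use assms in auto)
  then show ?thesis by (rule pr.linear_span_image)
qed

definition fat_conditions :: "nat \<Rightarrow> complex \<times> complex \<Rightarrow> (nat \<times> nat \<Rightarrow> complex) set" where
  "fat_conditions m p = taylor p ` {(i, j). i + j < m}"

text \<open>The dual form of the uniqueness of the curve of degree \<open>3 m\<close>.  On its multiples, the
  coefficient with exponents \<open>e\<close> is \<open>\<gamma> e\<close> times the coefficient of \<open>x ^ (3 m)\<close>; a linear relation that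
  holds on all solutions of a linear system is a combination of its equations.  On polynomials of
  higher degree, the combination \<open>\<beta>\<close> of the equations also involves coefficients of degree greater
  than \<open>3 m\<close>.\<close>

lemma nine_points_determine_coefficients:
  obtains \<gamma> :: "nat \<times> nat \<Rightarrow> complex"
  where "\<And>j. j \<le> 3 * m \<Longrightarrow> \<gamma> (3 * m - j, j) = of_nat (3 * m choose j) * \<sigma> ^ j"
    and "\<And>e. e \<in> exps (3 * m) \<Longrightarrow>
      \<exists>\<beta>\<in>fv.span (\<Union>l<9. fat_conditions m (nine_points \<sigma> l)).
        \<forall>z\<in>exps (3 * m). \<beta> z = (if z = e then 1 else 0) - (if z = (3 * m, 0) then \<gamma> e else 0)"
proof -
  let ?D = "exps (3 * m)" and ?S = "\<Union>l<9. fat_conditions m (nine_points \<sigma> l)"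
  let ?G = "\<lambda>e. coeff (coeff (sheared_cubic \<sigma> ^ m) (snd e)) (fst e)"
  define \<gamma> where "\<gamma> e = (- 1) ^ m * ?G e" for e
  have sq: "(- 1) ^ m * (- 1) ^ m = (1 :: complex)" by (simp flip: power_add mult_2)
  have top: "\<gamma> (3 * m - j, j) = of_nat (3 * m choose j) * \<sigma> ^ j" if "j \<le> 3 * m" for j
    using sheared_cubic_power_top[OF that, of \<sigma>] sq by (simp add: \<gamma>_def mult.assoc[symmetric])
  have "\<exists>\<beta>\<in>fv.span ?S. \<forall>z\<in>?D. \<beta> z = (if z = e then 1 else 0) - (if z = (3 * m, 0) then \<gamma> e else 0)"
    if e: "e \<in> ?D" for e
  proof -
    define w where "w = trunc ?D (\<lambda>z. (if z = e then 1 else 0) - (if z = (3 * m, 0) then \<gamma> e else 0))"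
    have "w \<in> fv.span (trunc ?D ` ?S)"
    proof (rule ccontr)
      assume "w \<notin> fv.span (trunc ?D ` ?S)"
      then have "\<exists>f. (\<forall>s\<in>trunc ?D ` ?S. pairing ?D f s = 0) \<and> pairing ?D f w = 1"
        by (intro separating_pairing) (auto simp: w_def supported_trunc)
      then obtain f where f: "\<And>s. s \<in> ?S \<Longrightarrow> pairing ?D f s = 0" "pairing ?D f w = 1"
        using pairing_trunc by (metis imageI)
      have "\<exists>c. \<forall>k l. k + l \<le> 3 * m \<longrightarrow> f (k, l) = c * coeff (coeff (sheared_cubic \<sigma> ^ m) l) k"
        by (rule polys_vanishing_on_nine_points, rule f(1)) (auto simp: fat_conditions_def)
      then obtain c where c: "\<And>k l. k + l \<le> 3 * m \<Longrightarrow> f (k, l) = c * ?G (k, l)"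
        by auto
      have "f (3 * m, 0) = c * (- 1) ^ m"
        using c[of "3 * m" 0] sheared_cubic_power_top[of 0 m \<sigma>] by simp
      moreover have "f e = c * ?G e" using c[of "fst e" "snd e"] e by (cases e) simp
      ultimately have "f e - \<gamma> e * f (3 * m, 0) = 0" using sq by (simp add: \<gamma>_def)
      moreover have "pairing ?D f w = (\<Sum>z\<in>?D. (if z = e then f z else 0) - (if z = (3 * m, 0) then \<gamma> e * f z else 0))"
        unfolding w_def pairing_trunc unfolding pairing_def by (intro sum.cong) (auto simp: algebra_simps)
      then have "pairing ?D f w = f e - \<gamma> e * f (3 * m, 0)"
        using e by (simp add: sum_subtractf sum.delta)
      ultimately show False using f(2) by simp
    qed
    also have "fv.span (trunc ?D ` ?S) = trunc ?D ` fv.span ?S"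
      by (rule span_image_linear) (auto simp: trunc_def fscale_apply fun_eq_iff)
    finally obtain \<beta> where "\<beta> \<in> fv.span ?S" "w = trunc ?D \<beta>" by blast
    then show ?thesis unfolding w_def trunc_def fun_eq_iff by metis
  qed
  with top show ?thesis by (rule that)
qed

section \<open>Collision of nine fat points\<close>

text \<open>Expanding at \<open>q\<close> and the result at \<open>v\<close> amounts to expanding at \<open>q + v\<close>.\<close>

lemma taylor_compose:
  assumes "(k, l) \<in> exps D" "e \<in> exps D"
  shows "taylor (q + v) e (k, l) = (\<Sum>z\<in>exps D. taylor q z (k, l) * taylor v e z)"
proof -
  have kl: "k + l \<le> D" using assms by simp
  have "(\<Sum>e\<in>exps D. cst (taylor (q + v) e (k, l)) * (varX ^ fst e * varY ^ snd e))
      = (cst (fst (q + v)) + varX) ^ k * (cst (snd (q + v)) + varY) ^ l"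
    by (rule taylor_expand[OF cst_add cst_mult cst_1 kl, symmetric])
  also have "\<dots> = (cst (fst q) + (cst (fst v) + varX)) ^ k * (cst (snd q) + (cst (snd v) + varY)) ^ l"
    by simp
  also have "\<dots> = (\<Sum>z\<in>exps D. cst (taylor q z (k, l))
      * ((cst (fst v) + varX) ^ fst z * (cst (snd v) + varY) ^ snd z))"
    by (rule taylor_expand[OF cst_add cst_mult cst_1 kl])
  also have "\<dots> = (\<Sum>e\<in>exps D. cst (pairing (exps D) (\<lambda>z. taylor q z (k, l)) (taylor v e))
      * (varX ^ fst e * varY ^ snd e))"
    by (rule subst_taylor_expand[OF cst_add cst_mult cst_1])
  finally have "coeff (coeff (\<Sum>e\<in>exps D. cst (taylor (q + v) e (k, l)) * (varX ^ fst e * varY ^ snd e)) (snd e)) (fst e)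
    = coeff (coeff (\<Sum>e\<in>exps D. cst (pairing (exps D) (\<lambda>z. taylor q z (k, l)) (taylor v e))
      * (varX ^ fst e * varY ^ snd e)) (snd e)) (fst e)" by simp
  then show ?thesis using assms(2) unfolding coeff_subst_vars by (simp add: pairing_def)
qed

definition dilate :: "complex \<Rightarrow> complex \<times> complex \<Rightarrow> complex \<times> complex" where
  "dilate t p = (t * fst p, t * snd p)"

definition size2 :: "nat \<times> nat \<Rightarrow> nat" where "size2 e = fst e + snd e"

lemma taylor_dilate: "t ^ size2 e * taylor (dilate t p) e z = t ^ size2 z * taylor p e z"
proof (cases "fst e \<le> fst z \<and> snd e \<le> snd z")
  case True
  then have "t ^ fst z = t ^ fst e * t ^ (fst z - fst e)" "t ^ snd z = t ^ snd e * t ^ (snd z - snd e)"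
    by (simp_all flip: power_add)
  then show ?thesis
    by (simp add: taylor_def dilate_def size2_def case_prod_beta power_add power_mult_distrib)
next
  case False
  then show ?thesis by (auto simp: taylor_def case_prod_beta binomial_eq_0)
qed

abbreviation cond :: "nat \<Rightarrow> complex \<times> complex \<Rightarrow> nat \<times> nat \<Rightarrow> nat \<times> nat \<Rightarrow> complex" where
  "cond d p e \<equiv> trunc (exps d) (taylor p e)"

lemma cond_eq_0: "e \<notin> exps d \<Longrightarrow> cond d p e = 0"
  by (auto simp: trunc_def taylor_def exps_def fun_eq_iff binomial_eq_0 case_prod_beta)

text \<open>The nine points \<open>q + t P\<close>, where \<open>P\<close> runs through \<open>nine_points\<close>, collide at \<open>q\<close> as \<open>t\<close>
  tends to \<open>0\<close>.  In coordinates dilated by \<open>t\<close> around \<open>q\<close>, a combination \<open>\<beta>\<close> of the conditions at the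
  points \<open>P\<close> becomes the combination of the Taylor coefficients at \<open>q\<close> in which that with exponents
  \<open>z\<close> has the factor \<open>t ^ size2 z * \<beta> z\<close>.  For the \<open>\<beta>\<close> that belongs to \<open>e\<close>, no \<open>z\<close> of size less than
  \<open>size2 e\<close> contributes, so one may divide by \<open>t ^ size2 e\<close>.  What remains at \<open>t = 0\<close> is the condition
  that the coefficient of \<open>e\<close> vanishes, if \<open>size2 e < 3 m\<close>, and a condition of proportionality to
  \<open>(x + \<sigma> y) ^ (3 m)\<close>, if \<open>size2 e = 3 m\<close>.  The unknown coefficients of \<open>\<beta>\<close> of size greater than \<open>3 m\<close>
  carry positive powers of \<open>t\<close> and disappear.\<close>

lemma collision_family:
  obtains \<Lambda> :: "nat \<times> nat \<Rightarrow> complex \<Rightarrow> nat \<times> nat \<Rightarrow> complex"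
  where "\<And>e z. is_poly (\<lambda>t. \<Lambda> e t z)"
    and "\<And>e t. supported (exps d) (\<Lambda> e t)"
    and "\<And>e t. e \<in> exps (3 * m) \<Longrightarrow> t \<noteq> 0 \<Longrightarrow>
      \<Lambda> e t \<in> fv.span (trunc (exps d) ` (\<Union>l<9. fat_conditions m (q + dilate t (nine_points \<sigma> l))))"
    and "\<And>e. size2 e < 3 * m \<Longrightarrow> \<Lambda> e 0 = cond d q e"
    and "\<And>j. 1 \<le> j \<Longrightarrow> j \<le> 3 * m \<Longrightarrow> \<Lambda> (3 * m - j, j) 0
      = cond d q (3 * m - j, j) - fscale (of_nat (3 * m choose j) * \<sigma> ^ j) (cond d q (3 * m, 0))"
proof -
  let ?S = "\<Union>l<9. fat_conditions m (nine_points \<sigma> l)"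
  let ?S' = "\<lambda>t. trunc (exps d) ` (\<Union>l<9. fat_conditions m (q + dilate t (nine_points \<sigma> l)))"
  let ?E = "exps (d + 3 * m)"
  obtain \<gamma> where \<gamma>: "\<And>j. j \<le> 3 * m \<Longrightarrow> \<gamma> (3 * m - j, j) = of_nat (3 * m choose j) * \<sigma> ^ j"
    and ex: "\<And>e. e \<in> exps (3 * m) \<Longrightarrow> \<exists>\<beta>\<in>fv.span ?S. \<forall>z\<in>exps (3 * m).
        \<beta> z = (if z = e then 1 else 0) - (if z = (3 * m, 0) then \<gamma> e else 0)"
    using nine_points_determine_coefficients[of m \<sigma>] by blast
  from ex obtain \<beta> where \<beta>_span: "\<And>e. e \<in> exps (3 * m) \<Longrightarrow> \<beta> e \<in> fv.span ?S"
    and \<beta>: "\<And>e z. e \<in> exps (3 * m) \<Longrightarrow> z \<in> exps (3 * m) \<Longrightarrow>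
        \<beta> e z = (if z = e then 1 else 0) - (if z = (3 * m, 0) then \<gamma> e else 0)"
    by metis
  \<comment> \<open>the action of the dilation by \<open>t\<close> around \<open>q\<close> on functionals\<close>
  define L where "L t b = (\<Sum>z\<in>?E. fscale (t ^ size2 z * b z) (cond d q z))" for t and b :: "nat \<times> nat \<Rightarrow> complex"
  have L_taylor: "L t (taylor p e) = fscale (t ^ size2 e) (cond d (q + dilate t p) e)"
    if "e \<in> ?E" for t p e
  proof
    fix x show "L t (taylor p e) x = fscale (t ^ size2 e) (cond d (q + dilate t p) e) x"
    proof (cases "x \<in> exps d")
      case True
      then have "taylor (q + dilate t p) e x = (\<Sum>z\<in>?E. taylor q z x * taylor (dilate t p) e z)"
        using taylor_compose[of "fst x" "snd x" "d + 3 * m" e q "dilate t p"] that by (simp add: exps_def case_prod_beta)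
      then have "t ^ size2 e * taylor (q + dilate t p) e x
          = (\<Sum>z\<in>?E. taylor q z x * (t ^ size2 e * taylor (dilate t p) e z))"
        by (simp add: sum_distrib_left mult_ac)
      then show ?thesis using True
        by (simp add: L_def sum_fun_apply fscale_apply trunc_def taylor_dilate mult_ac)
    qed (simp add: L_def sum_fun_apply fscale_apply trunc_def)
  qed
  have L_span: "L t b \<in> fv.span (?S' t)" if "b \<in> fv.span ?S" for t b
  proof -
    have "L t ` fv.span ?S = fv.span (L t ` ?S)"
      by (rule span_image_linear[symmetric])
        (simp_all add: L_def fun_eq_iff sum_fun_apply fscale_apply sum.distrib[symmetric] sum_distrib_left algebra_simps)
    moreover have "L t ` ?S \<subseteq> fv.span (?S' t)"
    proof clarify
      fix l s assume l: "l < (9::nat)" and "s \<in> fat_conditions m (nine_points \<sigma> l)"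
      then obtain e where e: "s = taylor (nine_points \<sigma> l) e" "fst e + snd e < m"
        by (auto simp: fat_conditions_def)
      have "e \<in> ?E" using e by (auto simp: exps_def)
      then have L: "L t s = fscale (t ^ size2 e) (cond d (q + dilate t (nine_points \<sigma> l)) e)"
        unfolding e(1) by (rule L_taylor)
      have "taylor (q + dilate t (nine_points \<sigma> l)) e \<in> fat_conditions m (q + dilate t (nine_points \<sigma> l))"
        using e(2) unfolding fat_conditions_def by (intro imageI) (simp add: case_prod_beta)
      then have "cond d (q + dilate t (nine_points \<sigma> l)) e \<in> ?S' t" using l by blast
      then show "L t s \<in> fv.span (?S' t)"
        unfolding L by (intro fv.span_scale fv.span_base)
    qed
    then have "fv.span (L t ` ?S) \<subseteq> fv.span (?S' t)"
      by (rule fv.span_minimal[OF _ fv.subspace_span])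
    ultimately show ?thesis using that by blast
  qed
  define \<Lambda> where "\<Lambda> e t = (\<Sum>z\<in>?E. if size2 e \<le> size2 z
      then fscale (t ^ (size2 z - size2 e) * \<beta> e z) (cond d q z) else 0)" for e t
  have at_0: "\<Lambda> e 0 = cond d q e - fscale b (cond d q (3 * m, 0))"
    if e: "e \<in> exps (3 * m)" and b: "b = (if size2 e = 3 * m then \<gamma> e else 0)" for e b
  proof -
    have "(if size2 e \<le> size2 z then fscale (0 ^ (size2 z - size2 e) * \<beta> e z) (cond d q z) else 0)
      = (if z = e then cond d q e else 0) - (if z = (3 * m, 0) then fscale b (cond d q z) else 0)" (is "?l = ?r") for z
    proof (cases "size2 z = size2 e")
      case True
      then have "z \<in> exps (3 * m)" using e by (auto simp: size2_def exps_def)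
      then have \<beta>_z: "\<beta> e z = (if z = e then 1 else 0) - (if z = (3 * m, 0) then b else 0)"
        using \<beta>[OF e] True b by (auto simp: size2_def)
      show ?thesis unfolding \<beta>_z True
        by (rule ext) (simp add: fscale_apply left_diff_distrib)
    next
      case False
      then have "?l = 0" by (auto simp: fun_eq_iff fscale_apply)
      moreover have "?r = 0" using False b by (auto simp: size2_def fun_eq_iff fscale_apply)
      ultimately show ?thesis by simp
    qed
    then have "\<Lambda> e 0 = (\<Sum>z\<in>?E. (if z = e then cond d q e else 0) - (if z = (3 * m, 0) then fscale b (cond d q z) else 0))"
      unfolding \<Lambda>_def by (intro sum.cong refl)
    also have "\<dots> = cond d q e - fscale b (cond d q (3 * m, 0))"
      using e by (cases e) (simp add: sum_subtractf sum.delta)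
    finally show ?thesis .
  qed
  show ?thesis
  proof (rule that[of \<Lambda>])
    show "is_poly (\<lambda>t. \<Lambda> e t z)" for e z
      unfolding \<Lambda>_def sum_fun_apply
    proof (rule is_poly_sum)
      fix x
      show "is_poly (\<lambda>t. (if size2 e \<le> size2 x
          then fscale (t ^ (size2 x - size2 e) * \<beta> e x) (cond d q x) else 0) z)"
        by (cases "size2 e \<le> size2 x") (simp_all add: fscale_apply is_poly_intros)
    qed
    show "supported (exps d) (\<Lambda> e t)" for e t
      unfolding supported_def \<Lambda>_def sum_fun_apply
      by (intro allI impI sum.neutral ballI) (simp add: fscale_apply trunc_def)
    show "\<Lambda> e t \<in> fv.span (?S' t)" if e: "e \<in> exps (3 * m)" and t: "t \<noteq> 0" for e t
    proof -
      have "L t (\<beta> e) = fscale (t ^ size2 e) (\<Lambda> e t)"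
      proof -
        have "fscale (t ^ size2 z * \<beta> e z) (cond d q z) = fscale (t ^ size2 e)
            (if size2 e \<le> size2 z then fscale (t ^ (size2 z - size2 e) * \<beta> e z) (cond d q z) else 0)" for z
        proof (cases "size2 e \<le> size2 z")
          case True
          then have "t ^ size2 z = t ^ size2 e * t ^ (size2 z - size2 e)" by (simp flip: power_add)
          then show ?thesis using True by (simp add: fun_eq_iff fscale_apply)
        next
          case False
          then have "z \<in> exps (3 * m)" "z \<noteq> e" "z \<noteq> (3 * m, 0)"
            using e by (auto simp: size2_def exps_def)
          then have "\<beta> e z = 0" using \<beta>[OF e] by simp
          then show ?thesis using False by (simp add: fun_eq_iff fscale_apply)
        qed
        then show ?thesis unfolding L_def \<Lambda>_def fv.scale_sum_right by (intro sum.cong refl)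
      qed
      moreover have "fscale (inverse (t ^ size2 e)) (L t (\<beta> e)) \<in> fv.span (?S' t)"
        by (intro fv.span_scale L_span \<beta>_span e)
      ultimately show ?thesis using t by (simp add: fv.scale_scale)
    qed
    show "\<Lambda> e 0 = cond d q e" if "size2 e < 3 * m" for e
      using at_0[of e 0] that by (simp add: size2_def exps_def case_prod_beta)
    show "\<Lambda> (3 * m - j, j) 0
      = cond d q (3 * m - j, j) - fscale (of_nat (3 * m choose j) * \<sigma> ^ j) (cond d q (3 * m, 0))"
      if "1 \<le> j" "j \<le> 3 * m" for j
      using at_0[of "(3 * m - j, j)"] that \<gamma>[of j] by (simp add: size2_def)
  qed
qed

definition conds :: "nat \<Rightarrow> (nat \<Rightarrow> nat) \<Rightarrow> nat \<Rightarrow> (nat \<Rightarrow> complex \<times> complex) \<Rightarrow> (nat \<times> nat \<Rightarrow> complex) set" where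
  "conds d \<mu> n Q = (\<Union>r<n. trunc (exps d) ` fat_conditions (\<mu> r) (Q r))"

lemma finite_lt_pairs [simp]: "finite {(i, j). i + j < (m :: nat)}"
  by (rule finite_subset[of _ "{..m} \<times> {..m}"]) auto

lemma finite_fat_conditions [simp]: "finite (fat_conditions m p)"
  by (simp add: fat_conditions_def)

lemma finite_conds [simp]: "finite (conds d \<mu> n Q)"
  by (simp add: conds_def)

text \<open>By semicontinuity, nine times as many points of multiplicity \<open>m\<close> impose at least as many
  conditions as their limit under a collision in groups of nine.\<close>

lemma collision_rank:
  fixes \<sigma> :: "nat \<Rightarrow> complex" and m :: nat
  defines "k \<equiv> 3 * m"
  shows "\<exists>Q'. rk (\<Union>i<n. trunc (exps d) ` fat_conditions k (Q i)
      \<union> power_conditions k (\<lambda>j. cond d (Q i) (k - j, j)) (\<sigma> i)) \<le> rk (conds d (\<lambda>_. m) (9 * n) Q')"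
proof -
  let ?S' = "\<lambda>i t. trunc (exps d) ` (\<Union>l<9. fat_conditions m (Q i + dilate t (nine_points (\<sigma> i) l)))"
  define P where "P i \<Lambda> \<longleftrightarrow> (\<forall>e z. is_poly (\<lambda>t. \<Lambda> e t z)) \<and> (\<forall>e t. supported (exps d) (\<Lambda> e t))
    \<and> (\<forall>e t. e \<in> exps k \<longrightarrow> t \<noteq> 0 \<longrightarrow> \<Lambda> e t \<in> fv.span (?S' i t))
    \<and> (\<forall>e. size2 e < k \<longrightarrow> \<Lambda> e 0 = cond d (Q i) e)
    \<and> (\<forall>j. 1 \<le> j \<longrightarrow> j \<le> k \<longrightarrow> \<Lambda> (k - j, j) 0
      = cond d (Q i) (k - j, j) - fscale (of_nat (k choose j) * \<sigma> i ^ j) (cond d (Q i) (k, 0)))" for i \<Lambda>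
  have "\<exists>\<Lambda>. P i \<Lambda>" for i
    unfolding P_def k_def by (rule collision_family[of d m "Q i" "\<sigma> i"]) blast
  then obtain \<Lambda> where \<Lambda>: "\<And>i. P i (\<Lambda> i)" by metis
  have poly: "is_poly (\<lambda>t. \<Lambda> i e t z)" and supp: "supported (exps d) (\<Lambda> i e t)" for i e t z
    using \<Lambda>[of i] unfolding P_def by blast+
  have span: "\<Lambda> i e t \<in> fv.span (?S' i t)" if "e \<in> exps k" "t \<noteq> 0" for i e t
    using \<Lambda>[of i] that unfolding P_def by blast
  have low: "\<Lambda> i e 0 = cond d (Q i) e" if "size2 e < k" for i e
    using \<Lambda>[of i] that unfolding P_def by blast
  have top: "\<Lambda> i (k - j, j) 0
      = cond d (Q i) (k - j, j) - fscale (of_nat (k choose j) * \<sigma> i ^ j) (cond d (Q i) (k, 0))"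
    if "1 \<le> j" "j \<le> k" for i j
    using \<Lambda>[of i] that unfolding P_def by blast
  let ?I = "{..<n} \<times> exps k"
  let ?v = "\<lambda>ie t. \<Lambda> (fst ie) (snd ie) t"
  have "finite {t. rk ((\<lambda>ie. ?v ie t) ` ?I) < rk ((\<lambda>ie. ?v ie 0) ` ?I)}"
    by (rule cofinite_rank_ge[of "exps d"]) (auto intro: poly supp)
  then have "finite (insert 0 {t. rk ((\<lambda>ie. ?v ie t) ` ?I) < rk ((\<lambda>ie. ?v ie 0) ` ?I)})"
    by (rule finite.insertI)
  from ex_new_if_finite[OF infinite_UNIV_char_0 this]
  obtain t where t: "t \<noteq> 0" "rk ((\<lambda>ie. ?v ie 0) ` ?I) \<le> rk ((\<lambda>ie. ?v ie t) ` ?I)"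
    unfolding insert_iff mem_Collect_eq de_Morgan_disj not_less by (elim exE conjE)
  define Q' where "Q' r = Q (r div 9) + dilate t (nine_points (\<sigma> (r div 9)) (r mod 9))" for r
  have "(\<Union>i<n. trunc (exps d) ` fat_conditions k (Q i)
      \<union> power_conditions k (\<lambda>j. cond d (Q i) (k - j, j)) (\<sigma> i)) \<subseteq> (\<lambda>ie. ?v ie 0) ` ?I"
  proof (intro UN_least Un_least subsetI)
    fix i x assume i: "i \<in> {..<n}" and "x \<in> trunc (exps d) ` fat_conditions k (Q i)"
    then obtain e where "x = cond d (Q i) e" "size2 e < k"
      by (auto simp: fat_conditions_def size2_def)
    then have "x = ?v (i, e) 0" "(i, e) \<in> ?I"
      using i low[of e i] by (auto simp: size2_def exps_def case_prod_beta)
    then show "x \<in> (\<lambda>ie. ?v ie 0) ` ?I" by (rule image_eqI)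
  next
    fix i x assume i: "i \<in> {..<n}"
      and "x \<in> power_conditions k (\<lambda>j. cond d (Q i) (k - j, j)) (\<sigma> i)"
    then obtain j where j: "1 \<le> j" "j \<le> k" and "x = cond d (Q i) (k - j, j)
        - fscale (of_nat (k choose j) * \<sigma> i ^ j) (cond d (Q i) (k - 0, 0))"
      unfolding power_conditions_def by auto
    then have "x = \<Lambda> i (k - j, j) 0" using top by simp
    with j have "x = ?v (i, (k - j, j)) 0" "(i, (k - j, j)) \<in> ?I"
      using i by simp_all
    then show "x \<in> (\<lambda>ie. ?v ie 0) ` ?I" by (rule image_eqI)
  qed
  then have "rk (\<Union>i<n. trunc (exps d) ` fat_conditions k (Q i)
      \<union> power_conditions k (\<lambda>j. cond d (Q i) (k - j, j)) (\<sigma> i)) \<le> rk ((\<lambda>ie. ?v ie 0) ` ?I)"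
    by (intro fv.dim_mono_finite subset_trans[OF _ fv.span_superset]) simp
  also have "\<dots> \<le> rk ((\<lambda>ie. ?v ie t) ` ?I)" by (rule t)
  also have "\<dots> \<le> rk (conds d (\<lambda>_. m) (9 * n) Q')"
  proof (rule fv.dim_mono_finite)
    show "(\<lambda>ie. ?v ie t) ` ?I \<subseteq> fv.span (conds d (\<lambda>_. m) (9 * n) Q')"
    proof clarsimp
      fix i a b assume i: "i < n" and "a + b \<le> k"
      then have "\<Lambda> i (a, b) t \<in> fv.span (?S' i t)" using t(1) by (intro span) auto
      moreover have "?S' i t \<subseteq> conds d (\<lambda>_. m) (9 * n) Q'"
        unfolding conds_def
      proof clarify
        fix l x assume "l < (9 :: nat)" "x \<in> fat_conditions m (Q i + dilate t (nine_points (\<sigma> i) l))"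
        then show "trunc (exps d) x \<in> (\<Union>r<9 * n. trunc (exps d) ` fat_conditions m (Q' r))"
          using i by (intro UN_I[of "9 * i + l"]) (auto simp: Q'_def)
      qed
      ultimately show "\<Lambda> i (a, b) t \<in> fv.span (conds d (\<lambda>_. m) (9 * n) Q')"
        using fv.span_mono by blast
    qed
  qed simp
  finally show ?thesis by blast
qed

section \<open>Points in general position\<close>

definition line :: "(nat \<Rightarrow> complex \<times> complex) \<Rightarrow> (nat \<Rightarrow> complex \<times> complex) \<Rightarrow> complex \<Rightarrow> nat \<Rightarrow> complex \<times> complex" where
  "line Q Q' t r = Q r + dilate t (Q' r - Q r)"

lemma line_0 [simp]: "line Q Q' 0 = Q" and line_1 [simp]: "line Q Q' 1 = Q'"
  by (auto simp: line_def dilate_def fun_eq_iff prod_eq_iff)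

lemma cofinite_conds_rank_ge:
  "finite {t. rk (conds d \<mu> n (line Q Q' t)) < rk (conds d \<mu> n (line Q Q' t0))}"
proof -
  let ?I = "SIGMA r:{..<n}. {(i, j). i + j < \<mu> r}"
  let ?v = "\<lambda>x t. cond d (line Q Q' t (fst x)) (snd x)"
  have conds: "conds d \<mu> n (line Q Q' t) = (\<lambda>x. ?v x t) ` ?I" for t
    by (force simp: conds_def fat_conditions_def)
  have "is_poly (\<lambda>t. ?v x t z)" for x z
    by (cases "z \<in> exps d")
      (auto simp: trunc_def taylor_def line_def dilate_def case_prod_beta intro!: is_poly_intros)
  then show ?thesis unfolding conds
    by (intro cofinite_rank_ge[of "exps d"]) (auto simp: supported_trunc)
qed

lemma conds_rank_le: "rk (conds d \<mu> n Q) \<le> card (conds d \<mu> n Q)"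
  by (rule fv.dim_le_card') simp

lemma conds_rank_bounded: "\<exists>b. \<forall>Q. rk (conds d \<mu> n Q) \<le> b"
proof -
  have "card (conds d \<mu> n Q) \<le> (\<Sum>r<n. card {(i, j). i + j < \<mu> r})" for Q
    unfolding conds_def fat_conditions_def image_image
    by (rule order.trans[OF card_UN_le]) (auto intro!: sum_mono card_image_le)
  then show ?thesis using conds_rank_le order.trans by blast
qed

text \<open>Two tuples are joined by a line, on which each rank falls below the value at one of its
  points only finitely often; so finitely many ranks can be maximised together.\<close>

lemma simultaneous_maximal_rank:
  assumes "finite M"
  shows "\<exists>Q. \<forall>\<mu>\<in>M. \<forall>Q'. rk (conds d \<mu> n Q') \<le> rk (conds d \<mu> n Q)"
  using assms
proof (induction M)
  case empty
  then show ?case by simp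
next
  case (insert \<mu> M)
  then obtain Q where Q: "\<And>\<nu> Q'. \<nu> \<in> M \<Longrightarrow> rk (conds d \<nu> n Q') \<le> rk (conds d \<nu> n Q)" by blast
  obtain Q'' where Q'': "\<And>Q'. rk (conds d \<mu> n Q') \<le> rk (conds d \<mu> n Q'')"
  proof -
    obtain b where "\<And>Q. rk (conds d \<mu> n Q) \<le> b" using conds_rank_bounded by blast
    then show thesis
      using ex_has_greatest_nat[of "\<lambda>_. True" Q "\<lambda>Q. rk (conds d \<mu> n Q)" "Suc b"] that
      by (auto simp: less_Suc_eq_le)
  qed
  let ?bad = "\<lambda>\<nu> t0. {t. rk (conds d \<nu> n (line Q Q'' t)) < rk (conds d \<nu> n (line Q Q'' t0))}"
  have "finite (?bad \<mu> 1 \<union> (\<Union>\<nu>\<in>M. ?bad \<nu> 0))"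
    using insert.hyps cofinite_conds_rank_ge by blast
  from ex_new_if_finite[OF infinite_UNIV_char_0 this] obtain t where
    t: "t \<notin> ?bad \<mu> 1" "\<And>\<nu>. \<nu> \<in> M \<Longrightarrow> t \<notin> ?bad \<nu> 0" by blast
  have "rk (conds d \<nu> n Q') \<le> rk (conds d \<nu> n (line Q Q'' t))" if "\<nu> \<in> insert \<mu> M" for \<nu> Q'
  proof (cases "\<nu> = \<mu>")
    case True
    then show ?thesis using t(1) Q''[of Q'] by simp
  next
    case False
    then show ?thesis using t(2)[of \<nu>] Q[of \<nu> Q'] that by simp
  qed
  then show ?case by blast
qed

lemma conds_permute:
  assumes "bij_betw \<pi> {..<n} {..<n}"
  shows "conds d (\<mu> \<circ> \<pi>) n (Q \<circ> \<pi>) = conds d \<mu> n Q"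
proof -
  have "conds d (\<mu> \<circ> \<pi>) n (Q \<circ> \<pi>) = (\<Union>r\<in>\<pi> ` {..<n}. trunc (exps d) ` fat_conditions (\<mu> r) (Q r))"
    by (simp add: conds_def)
  also have "\<pi> ` {..<n} = {..<n}" using assms by (simp add: bij_betw_def)
  finally show ?thesis by (simp only: conds_def)
qed

lemma conds_cong: "(\<And>r. r < n \<Longrightarrow> \<mu> r = \<nu> r) \<Longrightarrow> conds d \<mu> n Q = conds d \<nu> n Q"
  by (auto simp: conds_def)

definition raise :: "nat \<Rightarrow> nat set \<Rightarrow> nat \<Rightarrow> nat" where
  "raise k I r = (if r \<in> I then Suc k else k)"

lemma subset_bijection:
  assumes "finite A" "I \<subseteq> A" "J \<subseteq> A" "card I = card J"
  obtains \<pi> where "bij_betw \<pi> A A" "\<And>r. r \<in> A \<Longrightarrow> \<pi> r \<in> I \<longleftrightarrow> r \<in> J"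
proof -
  have fin: "finite I" "finite J" "finite (A - I)" "finite (A - J)"
    using assms finite_subset by auto
  obtain f where f: "bij_betw f J I"
    using fin assms(4) by (metis finite_same_card_bij)
  have "card (A - J) = card (A - I)"
    using assms fin by (simp add: card_Diff_subset)
  then obtain g where g: "bij_betw g (A - J) (A - I)"
    using fin by (metis finite_same_card_bij)
  define \<pi> where "\<pi> r = (if r \<in> J then f r else g r)" for r
  have "bij_betw \<pi> J I" using f by (rule bij_betw_cong[THEN iffD1, rotated]) (simp add: \<pi>_def)
  moreover have "bij_betw \<pi> (A - J) (A - I)"
    using g by (rule bij_betw_cong[THEN iffD1, rotated]) (simp add: \<pi>_def)
  ultimately have "bij_betw \<pi> (J \<union> (A - J)) (I \<union> (A - I))"
    by (rule bij_betw_combine) auto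
  then have "bij_betw \<pi> A A" using assms by (simp add: Un_absorb1)
  moreover have "\<pi> r \<in> I \<longleftrightarrow> r \<in> J" if "r \<in> A" for r
    using that bij_betwE[OF f] bij_betwE[OF g] by (auto simp: \<pi>_def)
  ultimately show thesis by (rule that)
qed

section \<open>Maximal rank for powers of nine\<close>

text \<open>Once a concave sequence decreases, it decreases up to the end.\<close>

lemma concave_ge_min_endpoints:
  fixes h :: "nat \<Rightarrow> int"
  assumes concave: "\<And>i. i + 2 \<le> n \<Longrightarrow> h (i + 2) + h i \<le> 2 * h (i + 1)" and "k \<le> n"
  shows "min (h 0) (h n) \<le> h k"
proof (rule ccontr)
  assume "\<not> min (h 0) (h n) \<le> h k"
  then have 0: "h k < h 0" and n: "h k < h n" by simp_all
  have "\<exists>i<k. h (Suc i) < h i"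
  proof (rule ccontr)
    assume "\<not> (\<exists>i<k. h (Suc i) < h i)"
    then have mono: "h i \<le> h (Suc i)" if "i < k" for i using that by (meson not_less)
    have "h 0 \<le> h i" if "i \<le> k" for i
      using that
    proof (induction i)
      case (Suc i)
      then show ?case using mono[of i] by simp
    qed simp
    then show False using 0 by force
  qed
  then obtain i where i: "i < k" "h (Suc i) < h i" by blast
  have decreasing: "h (Suc j) < h j" if "i \<le> j" "j < n" for j
    using that
  proof (induction j rule: dec_induct)
    case base
    then show ?case using i by simp
  next
    case (step j)
    then have "h (Suc j) < h j" by simp
    moreover have "h (j + 2) + h j \<le> 2 * h (j + 1)" using step by (intro concave) simp
    ultimately show ?case by simp
  qed
  have "h j \<le> h k" if "k \<le> j" "j \<le> n" for j
    using that
  proof (induction j rule: dec_induct)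
    case (step j)
    then have "h (Suc j) < h j" using i by (intro decreasing) auto
    then show ?case using step by simp
  qed simp
  then show False using n assms(2) by force
qed

text \<open>The conditions are imposed at one point after the other.  At each point they either raise
  the rank by at least their number \<open>k\<close> or have the effect of all the \<open>c i j\<close>, that is, of a multiplicity
  one higher; the latter points form the set \<open>K\<close>.  The set \<open>I\<close> of points with higher multiplicity
  among those that are still to come has to be arbitrary for the induction, and one \<open>\<sigma>\<close> at a
  time can serve all the finitely many \<open>I\<close>.\<close>

lemma power_conditions_rank:
  fixes c :: "nat \<Rightarrow> nat \<Rightarrow> 'a \<Rightarrow> complex"
  assumes "finite S" "j \<le> n"
  shows "\<exists>\<sigma>. \<forall>I\<subseteq>{j..<n}. \<exists>K\<subseteq>{..<j}.
      rk (S \<union> (\<Union>i\<in>K \<union> I. c i ` {..k})) + k * (j - card K)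
      \<le> rk (S \<union> (\<Union>i<j. power_conditions k (c i) (\<sigma> i)) \<union> (\<Union>i\<in>I. c i ` {..k}))"
  using assms(2)
proof (induction j)
  case 0
  then show ?case by simp
next
  case (Suc j)
  let ?C = "\<lambda>I. \<Union>i\<in>I. c i ` {..k}"
  let ?Z = "\<lambda>\<sigma> j. \<Union>i<j. power_conditions k (c i) (\<sigma> i)"
  obtain \<sigma> where \<sigma>: "\<And>I. I \<subseteq> {j..<n} \<Longrightarrow> \<exists>K\<subseteq>{..<j}.
      rk (S \<union> ?C (K \<union> I)) + k * (j - card K) \<le> rk (S \<union> ?Z \<sigma> j \<union> ?C I)"
    using Suc by (meson Suc_leD)
  let ?S = "\<lambda>I. S \<union> ?Z \<sigma> j \<union> ?C I"
  have fin: "finite (?S I)" if "I \<subseteq> {j..<n}" for I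
    using assms(1) finite_subset[OF that] by (auto simp: power_conditions_def)
  let ?bad = "\<lambda>I. {s. rk (?S I \<union> power_conditions k (c j) s) < min (rk (?S I \<union> c j ` {..k})) (rk (?S I) + k)}"
  have "finite (\<Union>I\<in>Pow {Suc j..<n}. ?bad I)"
  proof (intro finite_UN_I)
    fix I assume "I \<in> Pow {Suc j..<n}"
    then show "finite (?bad I)" by (intro cofinite_power_conditions_rank fin) auto
  qed simp
  from ex_new_if_finite[OF infinite_UNIV_char_0 this] obtain s
    where s: "\<And>I. I \<subseteq> {Suc j..<n} \<Longrightarrow> s \<notin> ?bad I" by blast
  have "\<exists>K\<subseteq>{..<Suc j}. rk (S \<union> ?C (K \<union> I)) + k * (Suc j - card K) \<le> rk (S \<union> ?Z (\<sigma>(j := s)) (Suc j) \<union> ?C I)"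
    if I: "I \<subseteq> {Suc j..<n}" for I
  proof -
    have Z: "?Z (\<sigma>(j := s)) (Suc j) = ?Z \<sigma> j \<union> power_conditions k (c j) s"
    proof -
      have "(\<Union>i<j. power_conditions k (c i) ((\<sigma>(j := s)) i)) = ?Z \<sigma> j"
        by (intro SUP_cong) auto
      then show ?thesis unfolding lessThan_Suc by auto
    qed
    have eq: "S \<union> ?Z (\<sigma>(j := s)) (Suc j) \<union> ?C I = ?S I \<union> power_conditions k (c j) s"
      unfolding Z by blast
    have "min (rk (?S I \<union> c j ` {..k})) (rk (?S I) + k) \<le> rk (?S I \<union> power_conditions k (c j) s)"
      using s[OF I] unfolding mem_Collect_eq not_less .
    then consider "rk (?S I \<union> c j ` {..k}) \<le> rk (?S I \<union> power_conditions k (c j) s)"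
      | "rk (?S I) + k \<le> rk (?S I \<union> power_conditions k (c j) s)" by linarith
    then show ?thesis
    proof cases
      case 1
      have "insert j I \<subseteq> {j..<n}" using I Suc.prems by auto
      from \<sigma>[OF this] obtain K where K: "K \<subseteq> {..<j}"
        "rk (S \<union> ?C (K \<union> insert j I)) + k * (j - card K) \<le> rk (S \<union> ?Z \<sigma> j \<union> ?C (insert j I))" by blast
      have "?S I \<union> c j ` {..k} = S \<union> ?Z \<sigma> j \<union> ?C (insert j I)" by blast
      moreover have "card (insert j K) = Suc (card K)"
        using K(1) finite_subset[OF K(1)] by (intro card_insert_disjoint) auto
      moreover have "insert j K \<union> I = K \<union> insert j I" by blast
      moreover have "insert j K \<subseteq> {..<Suc j}" using K(1) by auto
      ultimately show ?thesis using K(2) 1 unfolding eq by (intro exI[of _ "insert j K"]) simp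
    next
      case 2
      have "I \<subseteq> {j..<n}" using I by auto
      from \<sigma>[OF this] obtain K where K: "K \<subseteq> {..<j}"
        "rk (S \<union> ?C (K \<union> I)) + k * (j - card K) \<le> rk (?S I)" by blast
      have "card K \<le> j" using card_mono[OF _ K(1)] by simp
      then have "k * (Suc j - card K) = k * (j - card K) + k" by (simp add: Suc_diff_le)
      moreover have "K \<subseteq> {..<Suc j}" using K(1) by auto
      ultimately show ?thesis using K(2) 2 unfolding eq by (intro exI[of _ K]) simp
    qed
  qed
  then show ?case by blast
qed

text \<open>For some \<open>n\<close> points, the conditions of multiplicity \<open>m\<close> are independent or leave only the
  zero polynomial.\<close>

definition max_rank :: "nat \<Rightarrow> nat \<Rightarrow> nat \<Rightarrow> bool" where
  "max_rank d m n \<longleftrightarrow> (\<exists>Q. min (card (exps d)) (n * (m * (m + 1) div 2)) \<le> rk (conds d (\<lambda>_. m) n Q))"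

text \<open>For points in general position, the rank \<open>g I\<close> with multiplicity \<open>3 m + 1\<close> at the points of \<open>I\<close> and
  \<open>3 m\<close> elsewhere depends only on the cardinality of \<open>I\<close>, by symmetry, and is a concave function \<open>G\<close> of
  it, by submodularity.  In the limit of the collision the rank is at least \<open>G j + 3 m * (n - j)\<close> for some \<open>j\<close>.  This
  lower bound is concave in \<open>j\<close>, so it is smallest at \<open>j = 0\<close> or \<open>j = n\<close>, where \<open>G\<close> is bounded below by the
  hypotheses.  At \<open>j = 0\<close> the expected count is exact, since
  \<open>3 m * (3 m + 1) div 2 + 3 m = 9 * (m * (m + 1) div 2)\<close>.\<close>

lemma max_rank_nine_times:
  assumes "max_rank d (3 * m) n" "max_rank d (Suc (3 * m)) n"
  shows "max_rank d m (9 * n)"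
proof -
  define k where "k = 3 * m"
  define N where "N = card (exps d)"
  obtain Q where Q: "\<And>I Q'. I \<subseteq> {..<n} \<Longrightarrow> rk (conds d (raise k I) n Q') \<le> rk (conds d (raise k I) n Q)"
    using simultaneous_maximal_rank[of "raise k ` Pow {..<n}" d n] by auto
  define g where "g I = rk (conds d (raise k I) n Q)" for I
  define S where "S = conds d (\<lambda>_. k) n Q"
  define c where "c i j = cond d (Q i) (k - j, j)" for i j
  have fat_Suc: "trunc (exps d) ` fat_conditions (Suc k) (Q i) = trunc (exps d) ` fat_conditions k (Q i) \<union> c i ` {..k}" for i
  proof -
    have "{(a, b). a + b < Suc k} = {(a, b). a + b < k} \<union> (\<lambda>j. (k - j, j)) ` {..k}"
      by (auto simp: image_iff)
    then show ?thesis by (simp add: fat_conditions_def image_Un image_image c_def)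
  qed
  have raise_conds: "conds d (raise k I) n Q = S \<union> (\<Union>i\<in>I. c i ` {..k})" if "I \<subseteq> {..<n}" for I
  proof -
    have "trunc (exps d) ` fat_conditions (raise k I r) (Q r)
        = trunc (exps d) ` fat_conditions k (Q r) \<union> (if r \<in> I then c r ` {..k} else {})" for r
      by (simp add: raise_def fat_Suc)
    moreover have "(\<Union>r<n. A r \<union> (if r \<in> I then B r else {})) = (\<Union>r<n. A r) \<union> (\<Union>i\<in>I. B i)"
      for A B :: "nat \<Rightarrow> (nat \<times> nat \<Rightarrow> complex) set"
      using that by (auto split: if_splits)
    ultimately show ?thesis by (simp only: conds_def S_def)
  qed
  have sym: "g I = g J" if IJ: "I \<subseteq> {..<n}" "J \<subseteq> {..<n}" "card I = card J" for I J
  proof -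
    have le: "g I \<le> g J" if IJ: "I \<subseteq> {..<n}" "J \<subseteq> {..<n}" "card I = card J" for I J
    proof -
      obtain \<pi> where \<pi>: "bij_betw \<pi> {..<n} {..<n}" "\<And>r. r \<in> {..<n} \<Longrightarrow> \<pi> r \<in> I \<longleftrightarrow> r \<in> J"
        using subset_bijection[of "{..<n}" I J] IJ by blast
      have "conds d (raise k I) n Q = conds d (raise k I \<circ> \<pi>) n (Q \<circ> \<pi>)"
        by (rule conds_permute[OF \<pi>(1), symmetric])
      also have "\<dots> = conds d (raise k J) n (Q \<circ> \<pi>)"
        using \<pi>(2) by (intro conds_cong) (simp add: raise_def)
      finally show ?thesis unfolding g_def using Q[OF IJ(2)] by simp
    qed
    show ?thesis using le[of I J] le[of J I] IJ by simp
  qed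
  define G where "G j = g {..<j}" for j
  have G: "g I = G (card I)" if "I \<subseteq> {..<n}" for I
    using that card_mono[OF _ that] unfolding G_def by (intro sym) auto
  have concave: "G (i + 2) + G i \<le> 2 * G (i + 1)" if "i + 2 \<le> n" for i
  proof -
    let ?A = "conds d (raise k {..<i}) n Q" and ?c = "\<lambda>i. c i ` {..k}"
    have "rk (?A \<union> ?c i \<union> ?c (Suc i)) + rk ?A \<le> rk (?A \<union> ?c i) + rk (?A \<union> ?c (Suc i))"
      by (rule fv.dim_submodular) auto
    moreover have "{..<i + 2} = insert (Suc i) (insert i {..<i})" "{..<i + 1} = insert i {..<i}"
      by auto
    moreover have U: "?A \<union> (\<Union>x\<in>J. ?c x) = conds d (raise k (J \<union> {..<i})) n Q" if "J \<subseteq> {..<n}" for J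
      using that \<open>i + 2 \<le> n\<close> by (subst (1 2) raise_conds) auto
    have "?A \<union> ?c i \<union> ?c (Suc i) = conds d (raise k (insert (Suc i) (insert i {..<i}))) n Q"
      using U[of "{i, Suc i}"] that by (simp add: Un_assoc insert_commute)
    moreover have "?A \<union> ?c i = conds d (raise k (insert i {..<i})) n Q"
      using U[of "{i}"] that by simp
    moreover have "?A \<union> ?c (Suc i) = conds d (raise k (insert (Suc i) {..<i})) n Q"
      using U[of "{Suc i}"] that by simp
    moreover have "g (insert (Suc i) {..<i}) = G (i + 1)"
      using that by (subst G) auto
    ultimately show ?thesis by (simp add: g_def G_def)
  qed
  obtain \<sigma> K where K: "K \<subseteq> {..<n}" and
    "rk (S \<union> (\<Union>i\<in>K. c i ` {..k})) + k * (n - card K) \<le> rk (S \<union> (\<Union>i<n. power_conditions k (c i) (\<sigma> i)))"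
  proof -
    have "finite S" by (simp add: S_def)
    from power_conditions_rank[OF this order.refl[of n], of c k] that show thesis by auto
  qed
  then have "G (card K) + k * (n - card K) \<le> rk (S \<union> (\<Union>i<n. power_conditions k (c i) (\<sigma> i)))"
    by (simp add: G[OF K, symmetric] g_def raise_conds[OF K])
  also have "S \<union> (\<Union>i<n. power_conditions k (c i) (\<sigma> i))
      = (\<Union>i<n. trunc (exps d) ` fat_conditions k (Q i) \<union> power_conditions k (c i) (\<sigma> i))"
    by (auto simp: S_def conds_def)
  finally have le: "G (card K) + k * (n - card K)
      \<le> rk (\<Union>i<n. trunc (exps d) ` fat_conditions k (Q i) \<union> power_conditions k (c i) (\<sigma> i))" .
  obtain Q' where "rk (\<Union>i<n. trunc (exps d) ` fat_conditions k (Q i) \<union> power_conditions k (c i) (\<sigma> i))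
      \<le> rk (conds d (\<lambda>_. m) (9 * n) Q')"
    using collision_rank[where n = n and d = d and m = m and Q = Q and \<sigma> = \<sigma>]
    unfolding k_def[symmetric] c_def[abs_def] by blast
  with le have Q': "G (card K) + k * (n - card K) \<le> rk (conds d (\<lambda>_. m) (9 * n) Q')"
    by (rule order.trans)
  have card_K: "card K \<le> n" using card_mono[OF _ K] by simp
  let ?h = "\<lambda>j. int (G j) + int k * (int n - int j)"
  have "min (?h 0) (?h n) \<le> ?h (card K)"
  proof (rule concave_ge_min_endpoints[OF _ card_K])
    show "?h (i + 2) + ?h i \<le> 2 * ?h (i + 1)" if "i + 2 \<le> n" for i
      using concave[OF that] by (simp add: algebra_simps)
  qed
  moreover have "int (k * (n - card K)) = int k * (int n - int (card K))"
    using card_K by (simp add: of_nat_diff)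
  ultimately have *: "min (G 0 + k * n) (G n) \<le> rk (conds d (\<lambda>_. m) (9 * n) Q')"
  proof -
    assume a: "min (?h 0) (?h n) \<le> ?h (card K)"
      and b: "int (k * (n - card K)) = int k * (int n - int (card K))"
    have "?h 0 = int (G 0 + k * n)" "?h n = int (G n)" by simp_all
    moreover have "?h (card K) = int (G (card K) + k * (n - card K))" by (simp only: of_nat_add b)
    ultimately have "min (int (G 0 + k * n)) (int (G n)) \<le> int (G (card K) + k * (n - card K))"
      using a by (simp only:)
    then have "min (G 0 + k * n) (G n) \<le> G (card K) + k * (n - card K)"
      by (simp only: of_nat_min[symmetric] of_nat_le_iff)
    then show ?thesis using Q' by (rule order.trans)
  qed
  have "raise k {} = (\<lambda>_. k)" by (auto simp: raise_def)
  then have "min N (n * (k * (k + 1) div 2)) \<le> G 0"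
    using assms(1) Q[of "{}"] unfolding max_rank_def k_def[symmetric] N_def[symmetric] G_def g_def
    by (auto intro: order.trans)
  moreover have "conds d (raise k {..<n}) n Q' = conds d (\<lambda>_. Suc k) n Q'" for Q'
    by (rule conds_cong) (simp add: raise_def)
  then have "min N (n * (Suc k * (Suc k + 1) div 2)) \<le> G n"
    using assms(2) Q[of "{..<n}"] unfolding max_rank_def k_def[symmetric] N_def[symmetric] G_def g_def
    by (auto intro: order.trans)
  moreover have "n * (k * (k + 1) div 2) + k * n = 9 * n * (m * (m + 1) div 2)"
  proof -
    have "k * (k + 1) div 2 + k = 9 * (m * (m + 1) div 2)"
    proof -
      have "even (k * (k + 1))" "even (m * (m + 1))" by simp_all
      then have "2 * (k * (k + 1) div 2 + k) = 2 * (9 * (m * (m + 1) div 2))"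
        unfolding distrib_left dvd_mult_div_cancel mult.left_commute[of 2 9] by (simp add: k_def algebra_simps)
      then show ?thesis by simp
    qed
    then have "n * (k * (k + 1) div 2 + k) = n * (9 * (m * (m + 1) div 2))" by (rule arg_cong)
    then show ?thesis by (simp add: algebra_simps)
  qed
  moreover have "n * (k * (k + 1) div 2) + k * n \<le> n * (Suc k * (Suc k + 1) div 2)"
  proof -
    have "Suc k * (Suc k + 1) = k * (k + 1) + 2 * Suc k" by simp
    then have "Suc k * (Suc k + 1) div 2 = k * (k + 1) div 2 + Suc k" by simp
    then show ?thesis by (simp add: algebra_simps)
  qed
  ultimately have "min N (9 * n * (m * (m + 1) div 2)) \<le> min (G 0 + k * n) (G n)"
    by linarith
  with * show ?thesis unfolding max_rank_def N_def by (meson order.trans)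
qed

lemma card_lt_pairs: "card {(i, j). i + j < (m :: nat)} = m * (m + 1) div 2"
proof (induction m)
  case (Suc m)
  have "{(a, b). a + b < Suc m} = {(a, b). a + b < m} \<union> (\<lambda>j. (m - j, j)) ` {..m}"
    by (auto simp: image_iff)
  moreover have "card ((\<lambda>j. (m - j, j)) ` {..m}) = Suc m"
    by (subst card_image) (auto simp: inj_on_def)
  ultimately have "card {(a, b). a + b < Suc m} = m * (m + 1) div 2 + Suc m"
    using Suc.IH by (simp only:) (subst card_Un_disjoint, auto)
  then show ?case by simp
qed simp

text \<open>At the origin, the Taylor coefficients are the coefficients of the polynomial.\<close>

lemma max_rank_one: "max_rank d m 1"
  unfolding max_rank_def
proof (rule exI[of _ "\<lambda>_. 0"])
  let ?J = "{(i, j). i + j < min m (Suc d)}"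
  have T: "cond d 0 e = (\<lambda>z. if z = e then 1 else 0)" if "e \<in> ?J" for e
    using that by (auto simp: trunc_def taylor_def exps_def fun_eq_iff power_0_left binomial_eq_0 not_less)
  have "fv.independent (cond d 0 ` ?J)"
    unfolding fv.dependent_finite[OF finite_imageI[OF finite_lt_pairs]]
  proof (rule notI, elim exE conjE bexE)
    fix u v assume "v \<in> cond d 0 ` ?J" and v: "u v \<noteq> 0"
      and sum: "(\<Sum>v\<in>cond d 0 ` ?J. fscale (u v) v) = 0"
    then obtain e where "e \<in> ?J" "v = cond d 0 e" by blast
    with v have u: "u (cond d 0 e) \<noteq> 0" by simp
    have inj: "inj_on (cond d 0) ?J" using T by (intro inj_onI) (metis zero_neq_one)
    have "(\<Sum>e'\<in>?J. fscale (u (cond d 0 e')) (cond d 0 e')) = 0"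
      using sum unfolding sum.reindex[OF inj] o_def .
    then have "0 = (\<Sum>e'\<in>?J. fscale (u (cond d 0 e')) (cond d 0 e')) e" by (simp only: zero_fun_apply)
    also have "\<dots> = (\<Sum>e'\<in>?J. if e = e' then u (cond d 0 e') else 0)"
      unfolding sum_fun_apply by (intro sum.cong) (auto simp: T fscale_apply)
    also have "\<dots> = u (cond d 0 e)" using \<open>e \<in> ?J\<close>
      by (simp only: sum.delta'[OF finite_lt_pairs] if_True)
    finally show False using u by simp
  qed
  moreover have "card (cond d 0 ` ?J) = card ?J"
    using T by (intro card_image inj_onI) (metis zero_neq_one)
  ultimately have "rk (cond d 0 ` ?J) = card ?J" using fv.dim_eq_card_independent by metis
  also have "card ?J = min (card (exps d)) (m * (m + 1) div 2)"
  proof -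
    have "exps d = {(i, j). i + j < Suc d}" by (auto simp: exps_def)
    then have *: "card (exps d) = Suc d * (Suc d + 1) div 2" using card_lt_pairs by simp
    have mono: "a * (a + 1) div 2 \<le> b * (b + 1) div 2" if "a \<le> b" for a b :: nat
      using that by (intro div_le_mono mult_le_mono) auto
    show ?thesis
    proof (cases "m \<le> Suc d")
      case True
      then show ?thesis unfolding * card_lt_pairs using mono[OF True] by (simp add: min_def)
    next
      case False
      then show ?thesis unfolding * card_lt_pairs using mono[of "Suc d" m] by (simp add: min_def)
    qed
  qed
  finally have "rk (cond d 0 ` ?J) = min (card (exps d)) (1 * (m * (m + 1) div 2))" by simp
  moreover have "rk (cond d 0 ` ?J) \<le> rk (conds d (\<lambda>_. m) 1 (\<lambda>_. 0))"
    by (intro fv.dim_mono_finite subset_trans[OF _ fv.span_superset])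
      (auto simp: conds_def fat_conditions_def)
  ultimately show "min (card (exps d)) (1 * (m * (m + 1) div 2)) \<le> rk (conds d (\<lambda>_. m) 1 (\<lambda>_. 0))"
    by simp
qed

lemma max_rank_nine_power: "max_rank d m (9 ^ h)"
proof (induction h arbitrary: m)
  case 0
  then show ?case using max_rank_one by simp
next
  case (Suc h)
  then show ?case using max_rank_nine_times by simp
qed

text \<open>A tuple of maximal rank is moved along the line to some tuple of distinct points.\<close>

lemma max_rank_distinct:
  assumes "max_rank d m n"
  shows "\<exists>Q. inj_on Q {..<n} \<and> min (card (exps d)) (n * (m * (m + 1) div 2)) \<le> rk (conds d (\<lambda>_. m) n Q)"
proof -
  obtain Q where Q: "min (card (exps d)) (n * (m * (m + 1) div 2)) \<le> rk (conds d (\<lambda>_. m) n Q)"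
    using assms unfolding max_rank_def by blast
  define Q' where "Q' r = (of_nat r :: complex, 0 :: complex)" for r
  let ?x = "\<lambda>r t. fst (line Q Q' t r)"
  have "is_poly (\<lambda>t. ?x r t - ?x s t)" for r s
    by (auto simp: line_def dilate_def intro!: is_poly_intros)
  then have "finite {t. ?x r t - ?x s t = 0}" if "r \<noteq> s" for r s
    using that by (intro is_poly_finite_zeros[of _ 1]) (simp_all add: Q'_def)
  then have "finite (\<Union>(r, s)\<in>{(r, s) \<in> {..<n} \<times> {..<n}. r \<noteq> s}. {t. ?x r t - ?x s t = 0})"
    by (intro finite_UN_I) (auto intro: finite_subset[of _ "{..<n} \<times> {..<n}"])
  then have "finite ((\<Union>(r, s)\<in>{(r, s) \<in> {..<n} \<times> {..<n}. r \<noteq> s}. {t. ?x r t - ?x s t = 0})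
      \<union> {t. rk (conds d (\<lambda>_. m) n (line Q Q' t)) < rk (conds d (\<lambda>_. m) n (line Q Q' 0))})"
    using cofinite_conds_rank_ge by (rule finite_UnI)
  from ex_new_if_finite[OF infinite_UNIV_char_0 this] obtain t
    where t': "t \<notin> (\<Union>(r, s)\<in>{(r, s) \<in> {..<n} \<times> {..<n}. r \<noteq> s}. {t. ?x r t - ?x s t = 0})"
      "\<not> rk (conds d (\<lambda>_. m) n (line Q Q' t)) < rk (conds d (\<lambda>_. m) n (line Q Q' 0))" by blast
  have t: "?x r t \<noteq> ?x s t" if "r < n" "s < n" "r \<noteq> s" for r s
    using t'(1) that by auto
  have t2: "rk (conds d (\<lambda>_. m) n Q) \<le> rk (conds d (\<lambda>_. m) n (line Q Q' t))"
    using t'(2) by simp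
  have "inj_on (line Q Q' t) {..<n}" using t by (intro inj_onI) (metis lessThan_iff)
  with t2 Q show ?thesis by (meson order.trans)
qed

section \<open>Multiplicity at a point of the projective plane, independently of the chart\<close>

abbreviation lookup where "lookup \<equiv> Poly_Mapping.lookup"

abbreviation keys where "keys \<equiv> Poly_Mapping.keys"

definition mono_eval :: "(3 \<Rightarrow> complex) \<Rightarrow> monomial3 \<Rightarrow> complex" where
  "mono_eval x e = (\<Prod>j\<in>UNIV. x j ^ lookup e j)"

definition eval3 :: "poly3 \<Rightarrow> (3 \<Rightarrow> complex) \<Rightarrow> complex" where
  "eval3 F x = (\<Sum>e\<in>keys F. lookup F e * mono_eval x e)"

lemma eval3_superset:
  assumes "finite A" "keys F \<subseteq> A"
  shows "eval3 F x = (\<Sum>e\<in>A. lookup F e * mono_eval x e)"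
  unfolding eval3_def using assms by (intro sum.mono_neutral_left) (auto simp: in_keys_iff)

lemma eval3_add: "eval3 (F + G) x = eval3 F x + eval3 G x"
proof -
  have "keys (F + G) \<subseteq> keys F \<union> keys G" by (rule keys_add)
  then show ?thesis
    by (simp add: eval3_superset[of "keys F \<union> keys G"] lookup_add algebra_simps sum.distrib)
qed

lemma eval3_0: "eval3 0 x = 0" by (simp add: eval3_def)

lemma eval3_sum: "eval3 (sum G A) x = (\<Sum>i\<in>A. eval3 (G i) x)"
  by (induction A rule: infinite_finite_induct) (simp_all add: eval3_0 eval3_add)

lemma eval3_single: "eval3 (Poly_Mapping.single e c) x = c * mono_eval x e"
  by (cases "c = 0") (simp_all add: eval3_def)

lemma mono_eval_add: "mono_eval x (e + e') = mono_eval x e * mono_eval x e'"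
  by (simp add: mono_eval_def lookup_add power_add prod.distrib)

lemma poly_mapping_expand: "F = (\<Sum>e\<in>keys F. Poly_Mapping.single e (lookup F e))"
  by (rule poly_mapping_eqI)
    (auto simp: lookup_sum lookup_single when_def sum.delta in_keys_iff)

lemma eval3_mult: "eval3 (F * G) x = eval3 F x * eval3 G x"
proof -
  have "F * G = (\<Sum>e\<in>keys F. \<Sum>e'\<in>keys G. Poly_Mapping.single (e + e') (lookup F e * lookup G e'))"
    by (subst poly_mapping_expand[of F], subst poly_mapping_expand[of G])
      (simp add: sum_product mult_single)
  then have "eval3 (F * G) x = (\<Sum>e\<in>keys F. \<Sum>e'\<in>keys G. lookup F e * lookup G e' * (mono_eval x e * mono_eval x e'))"
    by (simp add: eval3_sum eval3_single mono_eval_add)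
  then show ?thesis
    by (simp add: eval3_def sum_product mult_ac)
qed

lemma eval3_const: "eval3 (poly_const c) x = c"
  by (simp add: poly_const_def eval3_single mono_eval_def)

lemma eval3_1: "eval3 1 x = 1"
  using eval3_const[of 1 x] by (simp add: poly_const_def)

lemma eval3_power: "eval3 (F ^ n) x = eval3 F x ^ n"
  by (induction n) (simp_all add: eval3_1 eval3_mult)

lemma eval3_prod: "eval3 (prod G A) x = (\<Prod>i\<in>A. eval3 (G i) x)"
  by (induction A rule: infinite_finite_induct) (simp_all add: eval3_1 eval3_mult)

lemma eval3_var: "eval3 (poly_var j) x = x j"
proof -
  have "(\<Prod>i\<in>UNIV. x i ^ lookup (Poly_Mapping.single j (1::nat)) i) = (\<Prod>i\<in>UNIV. if i = j then x i else 1)"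
    by (intro prod.cong) (auto simp: lookup_single when_def)
  then show ?thesis by (simp add: poly_var_def eval3_single mono_eval_def prod.delta)
qed

lemma eval3_subst: "eval3 (poly_subst g F) x = eval3 F (\<lambda>j. eval3 (g j) x)"
  unfolding poly_subst_def eval3_sum eval3_mult eval3_const eval3_prod eval3_power
    eval3_def[of F] mono_eval_def ..

lemma eval3_taylor:
  "eval3 (taylor_expansion i v F) x = eval3 F (\<lambda>j. if j = i then 1 else v $ j / v $ i + x j)"
proof -
  have "eval3 (if j = i then 1 else poly_const (v $ j / v $ i) + poly_var j) x
      = (if j = i then 1 else v $ j / v $ i + x j)" for j
    by (simp add: eval3_1 eval3_add eval3_const eval3_var)
  then show ?thesis by (simp add: taylor_expansion_def eval3_subst)
qed

lemma mono_eval_scale: "mono_eval (\<lambda>j. c * x j) e = c ^ mon_degree e * mono_eval x e"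
  by (simp add: mono_eval_def mon_degree_def power_mult_distrib prod.distrib power_sum)

lemma eval3_homogeneous:
  assumes "homogeneous d F"
  shows "eval3 F (\<lambda>j. c * x j) = c ^ d * eval3 F x"
  using assms by (simp add: eval3_def homogeneous_def mono_eval_scale sum_distrib_left mult_ac)

text \<open>The shape of a Taylor expansion in the chart \<open>i\<close> of a form of degree \<open>n\<close>.\<close>

definition local_poly :: "3 \<Rightarrow> nat \<Rightarrow> poly3 \<Rightarrow> bool" where
  "local_poly i n F \<longleftrightarrow> (\<forall>e\<in>keys F. mon_degree e \<le> n \<and> lookup e i = 0)"

lemma local_poly_add: "local_poly i n F \<Longrightarrow> local_poly i n G \<Longrightarrow> local_poly i n (F + G)"
  unfolding local_poly_def using keys_add[of F G] by blast

lemma local_poly_sum: "(\<And>x. x \<in> A \<Longrightarrow> local_poly i n (G x)) \<Longrightarrow> local_poly i n (sum G A)"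
proof (induction A rule: infinite_finite_induct)
  case (insert a A)
  then show ?case unfolding sum.insert[OF insert.hyps] by (intro local_poly_add) simp_all
qed (simp_all add: local_poly_def)

lemma local_poly_mult: "local_poly i n F \<Longrightarrow> local_poly i n' G \<Longrightarrow> local_poly i (n + n') (F * G)"
  unfolding local_poly_def
proof
  fix e assume F: "\<forall>e\<in>keys F. mon_degree e \<le> n \<and> lookup e i = 0"
    and G: "\<forall>e\<in>keys G. mon_degree e \<le> n' \<and> lookup e i = 0" and "e \<in> keys (F * G)"
  then obtain a b where ab: "e = a + b" "a \<in> keys F" "b \<in> keys G"
    using keys_mult[of F G] by blast
  then show "mon_degree e \<le> n + n' \<and> lookup e i = 0"
    using F G by (auto simp: mon_degree_def lookup_add sum.distrib intro: add_mono)
qed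

lemma local_poly_const: "local_poly i 0 (poly_const c)"
  by (simp add: local_poly_def poly_const_def mon_degree_def)

lemma local_poly_one: "local_poly i 0 1"
  using local_poly_const[of i 1] by (simp add: poly_const_def)

lemma local_poly_mono: "local_poly i n F \<Longrightarrow> n \<le> n' \<Longrightarrow> local_poly i n' F"
  by (auto simp: local_poly_def)

lemma local_poly_power: "local_poly i 1 F \<Longrightarrow> local_poly i n (F ^ n)"
proof (induction n)
  case (Suc n)
  then show ?case using local_poly_mult[of i 1 F n "F ^ n"] by simp
qed (simp add: local_poly_one)

lemma local_poly_prod:
  "(\<And>x. x \<in> A \<Longrightarrow> local_poly i (n x) (G x)) \<Longrightarrow> local_poly i (sum n A) (prod G A)"
proof (induction A rule: infinite_finite_induct)
  case (insert a A)
  then show ?case unfolding sum.insert[OF insert.hyps] prod.insert[OF insert.hyps]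
    by (intro local_poly_mult) simp_all
qed (simp_all add: local_poly_one)

lemma local_poly_var: "j \<noteq> i \<Longrightarrow> local_poly i 1 (poly_var j)"
  by (simp add: local_poly_def poly_var_def mon_degree_def lookup_single when_def)

lemma local_poly_taylor:
  assumes "homogeneous d F"
  shows "local_poly i d (taylor_expansion i v F)"
  unfolding taylor_expansion_def poly_subst_def
proof (rule local_poly_sum)
  fix e assume e: "e \<in> keys F"
  let ?g = "\<lambda>j. if j = i then 1 else poly_const (v $ j / v $ i) + poly_var j"
  have g: "local_poly i 1 (?g j)" for j
  proof (cases "j = i")
    case True
    then show ?thesis using local_poly_one[of i] by (auto intro: local_poly_mono)
  next
    case False
    have "local_poly i 1 (poly_const (v $ j / v $ i))"
      by (rule local_poly_mono[OF local_poly_const]) simp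
    then show ?thesis unfolding if_not_P[OF False]
      by (intro local_poly_add local_poly_var False)
  qed
  have "local_poly i (0 + (\<Sum>j\<in>UNIV. lookup e j)) (poly_const (lookup F e) * (\<Prod>j\<in>UNIV. ?g j ^ lookup e j))"
    by (intro local_poly_mult local_poly_const local_poly_prod local_poly_power g)
  moreover have "0 + (\<Sum>j\<in>UNIV. lookup e j) = d"
    using assms e by (simp add: homogeneous_def mon_degree_def)
  ultimately show "local_poly i d (poly_const (lookup F e) * (\<Prod>j\<in>UNIV. ?g j ^ lookup e j))" by simp
qed

text \<open>The multiplicity of a form at a point is read off, without a chart, from its restrictions to
  the lines in the vector space through a representative of the point.\<close>

definition zero_of_order :: "nat \<Rightarrow> (complex \<Rightarrow> complex) \<Rightarrow> bool" where
  "zero_of_order m g \<longleftrightarrow> (\<exists>h. is_poly h \<and> (\<forall>t. g t = t ^ m * h t))"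

lemma is_poly_prod: "(\<And>i. i \<in> A \<Longrightarrow> is_poly (f i)) \<Longrightarrow> is_poly (\<lambda>t. \<Prod>i\<in>A. f i t)"
  by (induction A rule: infinite_finite_induct) (auto intro: is_poly_const is_poly_mult)

lemma is_poly_eq_except_one:
  assumes "is_poly f" "is_poly g" "\<And>t. t \<noteq> a \<Longrightarrow> f t = g t"
  shows "f t = g t"
proof (rule ccontr)
  assume "f t \<noteq> g t"
  then have "f t - g t \<noteq> 0" by simp
  with is_poly_diff[OF assms(1,2)] have "finite {t. f t - g t = 0}"
    by (rule is_poly_finite_zeros)
  moreover have "UNIV - {a} \<subseteq> {t. f t - g t = 0}" using assms(3) by auto
  ultimately have "finite (UNIV - {a})" by (rule rev_finite_subset)
  then show False using infinite_UNIV_char_0[where 'a = complex] by simp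
qed

text \<open>Along the line through \<open>v\<close> in direction \<open>w\<close>, the local coordinates are \<open>t\<close> times a vector
  divided by \<open>v $ i + t * w i\<close>; homogeneity clears that denominator.\<close>

lemma zero_of_order_if_taylor:
  assumes F: "homogeneous d F" and v: "v $ i \<noteq> 0"
    and T: "\<forall>e\<in>keys (taylor_expansion i v F). m \<le> mon_degree e"
  shows "zero_of_order m (\<lambda>t. eval3 F (\<lambda>j. v $ j + t * w j))"
proof -
  let ?T = "taylor_expansion i v F"
  define y where "y j = (w j * v $ i - v $ j * w i) / v $ i" for j
  define h where "h t = (\<Sum>e\<in>keys ?T. lookup ?T e * mono_eval y e * t ^ (mon_degree e - m) * (v $ i + t * w i) ^ (d - mon_degree e))" for t
  have h_poly: "is_poly h" unfolding h_def by (intro is_poly_intros)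
  have deg: "mon_degree e \<le> d" "lookup e i = 0" if "e \<in> keys ?T" for e
    using local_poly_taylor[OF F, of i v] that by (auto simp: local_poly_def)
  have eq: "eval3 F (\<lambda>j. v $ j + t * w j) = t ^ m * h t" if t: "v $ i + t * w i \<noteq> 0" for t
  proof -
    let ?c = "v $ i + t * w i"
    have *: "?c * (if j = i then 1 else v $ j / v $ i + t / ?c * y j) = v $ j + t * w j" for j
    proof (cases "j = i")
      case False
      have "?c * (v $ j / v $ i + t / ?c * y j) = ?c * v $ j / v $ i + t * y j"
        using t by (simp add: distrib_left)
      also have "\<dots> = v $ j + t * w j"
        using v by (simp add: y_def divide_simps) (simp add: algebra_simps)
      finally show ?thesis using False by simp
    qed simp
    have "eval3 F (\<lambda>j. v $ j + t * w j)
        = eval3 F (\<lambda>j. ?c * (if j = i then 1 else v $ j / v $ i + t / ?c * y j))"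
      by (simp only: *)
    also have "\<dots> = ?c ^ d * eval3 F (\<lambda>j. if j = i then 1 else v $ j / v $ i + t / ?c * y j)"
      by (rule eval3_homogeneous[OF F])
    finally have "eval3 F (\<lambda>j. v $ j + t * w j)
        = ?c ^ d * eval3 F (\<lambda>j. if j = i then 1 else v $ j / v $ i + t / ?c * y j)" .
    also have "\<dots> = ?c ^ d * eval3 ?T (\<lambda>j. t / ?c * y j)" by (simp only: eval3_taylor)
    also have "\<dots> = (\<Sum>e\<in>keys ?T. ?c ^ d * (lookup ?T e * ((t / ?c) ^ mon_degree e * mono_eval y e)))"
      unfolding eval3_def mono_eval_scale sum_distrib_left by (rule refl)
    also have "\<dots> = (\<Sum>e\<in>keys ?T. t ^ m * (lookup ?T e * mono_eval y e * t ^ (mon_degree e - m) * ?c ^ (d - mon_degree e)))"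
    proof (rule sum.cong[OF refl])
      fix e assume e: "e \<in> keys ?T"
      have "t ^ mon_degree e = t ^ m * t ^ (mon_degree e - m)" using T e by (simp flip: power_add)
      moreover have "?c ^ d = ?c ^ mon_degree e * ?c ^ (d - mon_degree e)"
        using deg(1)[OF e] by (simp flip: power_add)
      ultimately show "?c ^ d * (lookup ?T e * ((t / ?c) ^ mon_degree e * mono_eval y e))
        = t ^ m * (lookup ?T e * mono_eval y e * t ^ (mon_degree e - m) * ?c ^ (d - mon_degree e))"
        using t by (simp add: power_divide)
    qed
    also have "\<dots> = t ^ m * h t" by (simp add: h_def sum_distrib_left)
    finally show ?thesis .
  qed
  have "eval3 F (\<lambda>j. v $ j + t * w j) = t ^ m * h t" for t
  proof (rule is_poly_eq_except_one[where f = "\<lambda>t. eval3 F (\<lambda>j. v $ j + t * w j)"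
        and g = "\<lambda>t. t ^ m * h t" and a = "- v $ i / w i"])
    show "is_poly (\<lambda>t. eval3 F (\<lambda>j. v $ j + t * w j))"
      unfolding eval3_def mono_eval_def by (intro is_poly_intros is_poly_prod)
    show "is_poly (\<lambda>t. t ^ m * h t)" by (intro is_poly_intros h_poly)
    fix t assume "t \<noteq> - v $ i / w i"
    moreover have "t = - v $ i / w i" if 0: "v $ i + t * w i = 0"
    proof -
      have "w i \<noteq> 0" using 0 v by auto
      moreover have "t * w i = - v $ i" using 0 by (simp add: eq_neg_iff_add_eq_0 add.commute)
      ultimately show ?thesis by (metis nonzero_mult_div_cancel_right)
    qed
    ultimately have "v $ i + t * w i \<noteq> 0" by blast
    then show "eval3 F (\<lambda>j. v $ j + t * w j) = t ^ m * h t" by (rule eq)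
  qed
  then show ?thesis unfolding zero_of_order_def using h_poly by blast
qed

lemma other_indices:
  fixes i :: 3
  obtains j k where "UNIV = {i, j, k}" "i \<noteq> j" "i \<noteq> k" "j \<noteq> k"
proof -
  have ne: "(1::3) \<noteq> 2" "(1::3) \<noteq> 3" "(2::3) \<noteq> 3" by simp_all
  consider "i = 1" | "i = 2" | "i = 3" using exhaust_3 by blast
  then show thesis
  proof cases
    case 1
    have "UNIV = {i, 2, 3}" unfolding 1 UNIV_3 ..
    then show thesis by (rule that) (use ne in \<open>auto simp: 1\<close>)
  next
    case 2
    have "UNIV = {i, 1, 3}" unfolding 2 UNIV_3 by (rule insert_commute)
    then show thesis by (rule that) (use ne in \<open>auto simp: 2\<close>)
  next
    case 3
    have "UNIV = {i, 1, 2}" unfolding 3 UNIV_3 by blast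
    then show thesis by (rule that) (use ne in \<open>auto simp: 3\<close>)
  qed
qed

text \<open>For directions \<open>w\<close> with \<open>w i = 0\<close> the line stays in the chart, so the restrictions show that
  the homogeneous parts of low degree of the Taylor expansion vanish as functions, hence as
  polynomials.\<close>

lemma taylor_if_zero_of_order:
  assumes F: "homogeneous d F" and v: "v $ i \<noteq> 0"
    and zero: "\<And>w. zero_of_order m (\<lambda>t. eval3 F (\<lambda>j. v $ j + t * w j))"
  shows "\<forall>e\<in>keys (taylor_expansion i v F). m \<le> mon_degree e"
proof (rule ccontr)
  let ?T = "taylor_expansion i v F"
  assume "\<not> (\<forall>e\<in>keys ?T. m \<le> mon_degree e)"
  then obtain e0 where e0: "e0 \<in> keys ?T" "mon_degree e0 < m" by (auto simp: not_le)
  define r where "r = mon_degree e0"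
  have no_i: "lookup e i = 0" if "e \<in> keys ?T" for e
    using local_poly_taylor[OF F, of i v] that by (auto simp: local_poly_def)
  obtain j k where jk: "UNIV = {i, j, k}" "i \<noteq> j" "i \<noteq> k" "j \<noteq> k" by (rule other_indices)
  have deg: "mon_degree e = lookup e i + lookup e j + lookup e k" for e
    unfolding mon_degree_def jk(1) using jk(2-4) by simp
  define w where "w s l = (if l = i then 0 else if l = j then 1 else s)" for s :: complex and l
  have w_eval: "mono_eval (w s) e = s ^ lookup e k" if "e \<in> keys ?T" for s e
    unfolding mono_eval_def jk(1) using jk(2-4) no_i[OF that] by (simp add: w_def)
  have sum0: "(\<Sum>e\<in>{e \<in> keys ?T. mon_degree e = r}. lookup ?T e * s ^ lookup e k) = 0" for s
  proof -
    obtain h where h: "is_poly h" "\<And>t. eval3 F (\<lambda>j. v $ j + t * (v $ i * w s j)) = t ^ m * h t"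
      using zero[of "\<lambda>j. v $ i * w s j"] unfolding zero_of_order_def by blast
    obtain H where H: "\<And>t. h t = poly H t" using h(1) unfolding is_poly_def by blast
    define P where "P = (\<Sum>e\<in>keys ?T. monom (lookup ?T e * s ^ lookup e k) (mon_degree e))"
    have "poly P t = poly (monom ((1 / v $ i) ^ d) m * H) t" for t
    proof -
      have "poly P t = (\<Sum>e\<in>keys ?T. lookup ?T e * (t ^ mon_degree e * mono_eval (w s) e))"
        by (simp add: P_def poly_sum poly_monom w_eval mult_ac)
      also have "\<dots> = eval3 ?T (\<lambda>j. t * w s j)" by (simp add: eval3_def mono_eval_scale)
      also have "\<dots> = eval3 F (\<lambda>j. 1 / v $ i * (v $ j + t * (v $ i * w s j)))"
        unfolding eval3_taylor using v
        by (intro arg_cong[of _ _ "eval3 F"] ext) (simp add: w_def distrib_left)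
      also have "\<dots> = (1 / v $ i) ^ d * (t ^ m * h t)"
        unfolding eval3_homogeneous[OF F] h(2) ..
      finally show ?thesis by (simp add: H poly_monom)
    qed
    then have "P = monom ((1 / v $ i) ^ d) m * H" using poly_eq_poly_eq_iff by blast
    then have "coeff P r = 0" using e0 by (simp add: coeff_monom_mult r_def)
    moreover have "coeff P r = (\<Sum>e\<in>keys ?T. if mon_degree e = r then lookup ?T e * s ^ lookup e k else 0)"
      by (simp add: P_def coeff_sum)
    ultimately show ?thesis by (simp add: sum.inter_filter)
  qed
  define R where "R = (\<Sum>e\<in>{e \<in> keys ?T. mon_degree e = r}. monom (lookup ?T e) (lookup e k))"
  have "poly R s = 0" for s using sum0[of s] by (simp add: R_def poly_sum poly_monom)
  then have "R = 0" using poly_all_0_iff_0 by blast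
  then have "0 = coeff R (lookup e0 k)" by simp
  also have "\<dots> = (\<Sum>e\<in>{e \<in> keys ?T. mon_degree e = r}. if e = e0 then lookup ?T e else 0)"
    unfolding R_def coeff_sum
  proof (rule sum.cong[OF refl])
    fix e assume e: "e \<in> {e \<in> keys ?T. mon_degree e = r}"
    have "e = e0" if "lookup e k = lookup e0 k"
    proof (rule poly_mapping_eqI)
      fix l have "l \<in> {i, j, k}" using jk(1) by blast
      then show "lookup e l = lookup e0 l"
        using that e e0 no_i[of e] no_i[of e0] deg[of e] deg[of e0] by (auto simp: r_def)
    qed
    then show "coeff (monom (lookup ?T e) (lookup e k)) (lookup e0 k) = (if e = e0 then lookup ?T e else 0)"
      by auto
  qed
  also have "\<dots> = lookup ?T e0" using e0 by (simp add: sum.delta r_def)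
  finally show False using e0 by (simp add: in_keys_iff)
qed

lemma taylor_order_chart_independent:
  assumes "homogeneous d F" "v $ i \<noteq> 0" "v $ i' \<noteq> 0"
    and "\<forall>e\<in>keys (taylor_expansion i v F). m \<le> mon_degree e"
  shows "\<forall>e\<in>keys (taylor_expansion i' v F). m \<le> mon_degree e"
  using taylor_if_zero_of_order[OF assms(1,3)] zero_of_order_if_taylor[OF assms(1,2,4)] by blast

section \<open>Dimensions of linear systems\<close>

definition monomial :: "nat \<Rightarrow> nat \<times> nat \<Rightarrow> monomial3" where
  "monomial d z = Poly_Mapping.single 1 (d - (fst z + snd z))
     + Poly_Mapping.single 2 (fst z) + Poly_Mapping.single 3 (snd z)"

lemma indices_distinct: "(1::3) \<noteq> 2" "(1::3) \<noteq> 3" "(2::3) \<noteq> 3"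
  by simp_all

lemma lookup_monomial:
  "lookup (monomial d z) 1 = d - (fst z + snd z)"
  "lookup (monomial d z) 2 = fst z" "lookup (monomial d z) 3 = snd z"
  using indices_distinct by (auto simp: monomial_def lookup_add lookup_single when_def)

lemma mon_degree_3: "mon_degree e = lookup e 1 + lookup e 2 + lookup e 3"
  unfolding mon_degree_def sum_3 ..

lemma mon_degree_monomial: "z \<in> exps d \<Longrightarrow> mon_degree (monomial d z) = d"
  by (cases z) (simp add: mon_degree_3 lookup_monomial)

lemma monomial_eq_iff:
  assumes "mon_degree e = d"
  shows "monomial d z = e \<longleftrightarrow> z = (lookup e 2, lookup e 3)"
proof
  assume "z = (lookup e 2, lookup e 3)"
  then have "lookup (monomial d z) 1 = lookup e 1" "lookup (monomial d z) 2 = lookup e 2"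
    "lookup (monomial d z) 3 = lookup e 3"
    using assms by (simp_all add: lookup_monomial mon_degree_3)
  then show "monomial d z = e" by (intro poly_mapping_eqI) (metis exhaust_3)
qed (auto simp: lookup_monomial)

lemma exps_lookup: "mon_degree e = d \<Longrightarrow> (lookup e 2, lookup e 3) \<in> exps d"
  by (simp add: mon_degree_3)

lemma inj_monomial: "inj (monomial d)"
  by (intro injI) (metis lookup_monomial(2,3) prod_eqI)

definition monomials :: "nat \<Rightarrow> poly3 set" where
  "monomials d = (\<lambda>z. Poly_Mapping.single (monomial d z) 1) ` exps d"

lemma inj_monomials: "inj (\<lambda>z. Poly_Mapping.single (monomial d z) (1::complex))"
  by (intro injI) (metis inj_monomial injD keys_single one_neq_zero singleton_insert_inj_eq)

lemma finite_monomials: "finite (monomials d)" by (simp add: monomials_def)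

lemma card_monomials: "card (monomials d) = card (exps d)"
  unfolding monomials_def by (intro card_image inj_on_subset[OF inj_monomials]) simp

lemma lookup_form:
  "lookup (\<Sum>z\<in>exps d. poly_scale (f z) (Poly_Mapping.single (monomial d z) 1)) e
    = (if mon_degree e = d then f (lookup e 2, lookup e 3) else 0)"
proof -
  have "lookup (\<Sum>z\<in>exps d. poly_scale (f z) (Poly_Mapping.single (monomial d z) 1)) e
    = (\<Sum>z\<in>exps d. if monomial d z = e then f z else 0)"
    unfolding lookup_sum by (intro sum.cong) (auto simp: lookup_poly_scale lookup_single when_def)
  also have "\<dots> = (if mon_degree e = d then f (lookup e 2, lookup e 3) else 0)"
  proof (cases "mon_degree e = d")
    case True
    then show ?thesis using exps_lookup[OF True] by (simp add: monomial_eq_iff sum.delta)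
  next
    case False
    then have "monomial d z \<noteq> e" if "z \<in> exps d" for z using mon_degree_monomial[OF that] by auto
    then show ?thesis using False by (auto intro: sum.neutral)
  qed
  finally show ?thesis .
qed

lemma homogeneous_expand:
  assumes "homogeneous d F"
  shows "F = (\<Sum>z\<in>exps d. poly_scale (lookup F (monomial d z)) (Poly_Mapping.single (monomial d z) 1))"
proof (rule poly_mapping_eqI)
  fix e
  show "lookup F e = lookup (\<Sum>z\<in>exps d. poly_scale (lookup F (monomial d z)) (Poly_Mapping.single (monomial d z) 1)) e"
  proof (cases "mon_degree e = d")
    case True
    then have "monomial d (lookup e 2, lookup e 3) = e" by (simp add: monomial_eq_iff)
    then show ?thesis unfolding lookup_form using True by simp
  next
    case False
    then have "e \<notin> keys F" using assms by (auto simp: homogeneous_def)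
    then show ?thesis unfolding lookup_form using False by (simp add: in_keys_iff)
  qed
qed

lemma homogeneous_form: "homogeneous d (\<Sum>z\<in>exps d. poly_scale (f z) (Poly_Mapping.single (monomial d z) 1))"
proof -
  have "mon_degree e = d"
    if "lookup (\<Sum>z\<in>exps d. poly_scale (f z) (Poly_Mapping.single (monomial d z) 1)) e \<noteq> 0" for e
    using that unfolding lookup_form by (simp split: if_splits)
  then show ?thesis unfolding homogeneous_def by (simp add: in_keys_iff)
qed

lemma subspace_homogeneous: "poly3.subspace {F. homogeneous d F}"
proof (rule poly3.subspaceI)
  show "x + y \<in> {F. homogeneous d F}" if "x \<in> {F. homogeneous d F}" "y \<in> {F. homogeneous d F}" for x y
    using that keys_add[of x y] by (auto simp: homogeneous_def)
qed (auto simp: homogeneous_def in_keys_iff lookup_poly_scale)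

lemma homogeneous_span: "{F. homogeneous d F} \<subseteq> poly3.span (monomials d)"
proof clarify
  fix F assume "homogeneous d F"
  then show "F \<in> poly3.span (monomials d)"
    by (subst homogeneous_expand)
      (auto simp: monomials_def intro!: poly3.span_sum poly3.span_scale intro: poly3.span_base)
qed

lemma independent_monomials: "poly3.independent (monomials d)"
  unfolding poly3.dependent_finite[OF finite_monomials]
proof (rule notI, elim exE conjE bexE)
  fix u v assume "v \<in> monomials d" and v: "u v \<noteq> 0"
    and sum: "(\<Sum>v\<in>monomials d. poly_scale (u v) v) = 0"
  then obtain z where z: "z \<in> exps d" "v = Poly_Mapping.single (monomial d z) 1"
    by (auto simp: monomials_def)
  let ?f = "\<lambda>z. u (Poly_Mapping.single (monomial d z) 1)"
  have "(\<Sum>z\<in>exps d. poly_scale (?f z) (Poly_Mapping.single (monomial d z) 1)) = 0"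
    using sum unfolding monomials_def by (subst (asm) sum.reindex) (auto intro: inj_on_subset[OF inj_monomials])
  then have "lookup (\<Sum>z\<in>exps d. poly_scale (?f z) (Poly_Mapping.single (monomial d z) 1)) (monomial d z) = 0"
    by simp
  then have "?f z = 0"
    unfolding lookup_form using z(1) by (simp add: mon_degree_monomial lookup_monomial)
  then show False using v z(2) by simp
qed

lemma dim_homogeneous: "poly3.dim {F. homogeneous d F} = card (exps d)"
proof -
  have "monomials d \<subseteq> {F. homogeneous d F}"
    by (auto simp: monomials_def homogeneous_def mon_degree_monomial)
  then have "card (monomials d) = poly3.dim {F. homogeneous d F}"
    by (intro poly3.basis_card_eq_dim homogeneous_span independent_monomials)
  then show ?thesis by (simp add: card_monomials)
qed

lemma eval3_scale: "eval3 (poly_scale c F) x = c * eval3 F x"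
proof -
  have "keys (poly_scale c F) \<subseteq> keys F" by (auto simp: in_keys_iff lookup_poly_scale)
  then show ?thesis
    by (simp add: eval3_superset[of "keys F"] lookup_poly_scale sum_distrib_left mult.assoc)
qed

lemma mono_eval_3: "mono_eval x e = x 1 ^ lookup e 1 * x 2 ^ lookup e 2 * x 3 ^ lookup e 3"
  unfolding mono_eval_def UNIV_3 using indices_distinct by (simp add: mult.assoc)

lemma eval3_affine:
  assumes "homogeneous d F" "x 1 = 1"
  shows "eval3 F x = (\<Sum>z\<in>exps d. lookup F (monomial d z) * (x 2 ^ fst z * x 3 ^ snd z))"
  by (subst homogeneous_expand[OF assms(1)])
    (simp add: eval3_sum eval3_scale eval3_single mono_eval_3 lookup_monomial assms(2))

definition affine_point :: "complex \<times> complex \<Rightarrow> proj_plane" where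
  "affine_point p = abs_proj_plane (vector [1, fst p, snd p])"

lemma proportional_refl: "proportional v v \<longleftrightarrow> v \<noteq> 0"
  unfolding proportional_def by (auto intro: exI[of _ 1])

lemma vector_1_nonzero: "(vector [1, a, b] :: complex ^ 3) \<noteq> 0"
  by (metis vector_3(1) zero_index zero_neq_one)

lemma inj_affine_point: "inj affine_point"
proof (rule injI)
  fix p p' assume "affine_point p = affine_point p'"
  then have "proportional (vector [1, fst p, snd p]) (vector [1, fst p', snd p'])"
    unfolding affine_point_def
    by (subst Quotient_rel[OF Quotient_proj_plane, symmetric]) (simp add: proportional_refl vector_1_nonzero)
  then obtain c where c: "vector [1, fst p', snd p'] = c *s (vector [1, fst p, snd p] :: complex ^ 3)"
    by (auto simp: proportional_def)
  then have "(vector [1, fst p', snd p'] :: complex ^ 3) $ i = c * vector [1, fst p, snd p] $ i" for i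
    by (simp only: vector_smult_component)
  from this[of 1] this[of 2] this[of 3] show "p = p'" by (simp add: prod_eq_iff)
qed

text \<open>In the chart in which the first coordinate is \<open>1\<close>, the Taylor expansion of the form is that
  of the corresponding polynomial in two variables.\<close>

lemma vanishes_at_affine_point:
  assumes F: "homogeneous d F" and van: "vanishes_to_order m F (affine_point p)" and ij: "i + j < m"
  shows "pairing (exps d) (\<lambda>z. lookup F (monomial d z)) (taylor p (i, j)) = 0"
proof -
  let ?v = "vector [1, fst p, snd p] :: complex ^ 3"
  let ?T = "taylor_expansion 1 ?v F" and ?f = "\<lambda>z. lookup F (monomial d z)"
  have "\<forall>i. ?v $ i \<noteq> 0 \<longrightarrow> (\<forall>e\<in>keys (taylor_expansion i ?v F). m \<le> mon_degree e)"
    using van unfolding affine_point_def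
    by (subst (asm) vanishes_to_order.abs_eq) (simp_all add: proportional_refl vector_1_nonzero)
  then have T: "\<forall>e\<in>keys ?T. m \<le> mon_degree e" by (auto dest: spec[of _ 1])
  have no_1: "lookup e 1 = 0" if "e \<in> keys ?T" for e
    using local_poly_taylor[OF F, of 1 ?v] that by (auto simp: local_poly_def)
  have "(\<Sum>e\<in>exps d. cst (pairing (exps d) ?f (taylor p e)) * (varX ^ fst e * varY ^ snd e))
      = (\<Sum>e\<in>keys ?T. cst (lookup ?T e) * (varX ^ lookup e 2 * varY ^ lookup e 3))"
  proof (rule eval2_inject)
    fix x y :: complex
    let ?x = "\<lambda>j::3. if j = 2 then x else if j = 3 then y else 0"
    have "eval2 (\<Sum>e\<in>exps d. cst (pairing (exps d) ?f (taylor p e)) * (varX ^ fst e * varY ^ snd e)) x y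
        = (\<Sum>e\<in>exps d. pairing (exps d) ?f (taylor p e) * (x ^ fst e * y ^ snd e))"
      by (simp add: eval2_sum del: mult_pCons_left)
    also have "\<dots> = (\<Sum>z\<in>exps d. ?f z * ((fst p + x) ^ fst z * (snd p + y) ^ snd z))"
      by (rule subst_taylor_expand[of "\<lambda>c. c", symmetric]) simp_all
    also have "\<dots> = eval3 F (\<lambda>j. if j = 1 then 1 else ?v $ j / ?v $ 1 + ?x j)"
      using indices_distinct by (subst eval3_affine[OF F]) simp_all
    also have "\<dots> = eval3 ?T ?x" by (simp only: eval3_taylor)
    also have "\<dots> = (\<Sum>e\<in>keys ?T. lookup ?T e * (x ^ lookup e 2 * y ^ lookup e 3))"
      unfolding eval3_def using no_1 indices_distinct by (intro sum.cong) (simp_all add: mono_eval_3)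
    also have "\<dots> = eval2 (\<Sum>e\<in>keys ?T. cst (lookup ?T e) * (varX ^ lookup e 2 * varY ^ lookup e 3)) x y"
      by (simp add: eval2_sum del: mult_pCons_left)
    finally show "eval2 (\<Sum>e\<in>exps d. cst (pairing (exps d) ?f (taylor p e)) * (varX ^ fst e * varY ^ snd e)) x y = \<dots>" .
  qed
  then have eq: "coeff (coeff (\<Sum>e\<in>exps d. cst (pairing (exps d) ?f (taylor p e)) * (varX ^ fst e * varY ^ snd e)) j) i
      = coeff (coeff (\<Sum>e\<in>keys ?T. cst (lookup ?T e) * (varX ^ lookup e 2 * varY ^ lookup e 3)) j) i"
    by simp
  have "coeff (coeff (cst (lookup ?T e) * (varX ^ lookup e 2 * varY ^ lookup e 3)) j) i = 0"
    if "e \<in> keys ?T" for e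
  proof -
    have "m \<le> lookup e 2 + lookup e 3" using T no_1[OF that] that by (auto simp: mon_degree_3)
    then show ?thesis using ij unfolding cst_vars_monom by auto
  qed
  then have "coeff (coeff (\<Sum>e\<in>keys ?T. cst (lookup ?T e) * (varX ^ lookup e 2 * varY ^ lookup e 3)) j) i = 0"
    unfolding coeff_sum by (intro sum.neutral) blast
  with eq have *: "(if (i, j) \<in> exps d then pairing (exps d) ?f (taylor p (i, j)) else 0) = 0"
    unfolding coeff_subst_vars by simp
  show ?thesis
  proof (cases "(i, j) \<in> exps d")
    case False
    then have "cond d p (i, j) = 0" by (rule cond_eq_0)
    then show ?thesis using pairing_trunc[of "exps d" ?f "taylor p (i, j)"] by (simp add: pairing_def)
  qed (use * in simp)
qed

text \<open>Forms dual to a maximal independent set of conditions are independent modulo the linear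
  system.\<close>

lemma linear_system_dim_le_rank:
  "poly3.dim (linear_system d m n (affine_point \<circ> Q)) + rk (conds d (\<lambda>_. m) n Q) \<le> card (exps d)"
proof -
  let ?L = "linear_system d m n (affine_point \<circ> Q)"
  let ?c = "\<lambda>F z. lookup F (monomial d z)"
  obtain B where B: "B \<subseteq> conds d (\<lambda>_. m) n Q" "fv.independent B" "card B = rk (conds d (\<lambda>_. m) n Q)"
    by (rule fv.basis_exists)
  have fB: "finite B" using B(1) finite_conds finite_subset by blast
  have supp: "supported (exps d) b" if "b \<in> B" for b
    using B(1) that by (auto simp: conds_def supported_trunc)
  have "\<forall>b. \<exists>f. \<forall>b'\<in>B. pairing (exps d) f b' = (if b' = b then 1 else 0)"
    by (intro allI independent_prescribed_pairing finite_exps B(2) supp)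
  then obtain f where f: "\<And>b b'. b' \<in> B \<Longrightarrow> pairing (exps d) (f b) b' = (if b' = b then 1 else 0)"
    by metis
  define G where "G b = (\<Sum>z\<in>exps d. poly_scale (f b z) (Poly_Mapping.single (monomial d z) 1))" for b
  have G: "?c (G b) z = f b z" if "z \<in> exps d" for b z
    unfolding G_def lookup_form using that by (simp add: mon_degree_monomial lookup_monomial)
  have "poly3.dim ?L + card B \<le> card (monomials d)"
  proof (rule poly3.dim_common_kernel_le[where f = "\<lambda>b F. pairing (exps d) (?c F) b" and F = G])
    show "?L \<subseteq> poly3.span (monomials d)"
      using homogeneous_span by (auto simp: linear_system_def)
    show "pairing (exps d) (?c (x + y)) b = pairing (exps d) (?c x) b + pairing (exps d) (?c y) b" for b x y
      by (simp add: pairing_def lookup_add algebra_simps sum.distrib)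
    show "pairing (exps d) (?c (poly_scale c x)) b = c * pairing (exps d) (?c x) b" for b c x
      by (simp add: pairing_def lookup_poly_scale sum_distrib_left mult.assoc)
    show "G b \<in> poly3.span (monomials d)" for b
      using homogeneous_span homogeneous_form[of d "f b"] by (auto simp: G_def)
    show "pairing (exps d) (?c (G b')) b = (if b = b' then 1 else 0)" if "b \<in> B" for b b'
    proof -
      have "pairing (exps d) (?c (G b')) b = pairing (exps d) (f b') b"
        unfolding pairing_def by (intro sum.cong refl) (simp only: G)
      then show ?thesis using f[OF that] by simp
    qed
    show "pairing (exps d) (?c F) b = 0" if "b \<in> B" "F \<in> ?L" for b F
    proof -
      obtain r i j where r: "r < n" "i + j < m" "b = cond d (Q r) (i, j)"
        using B(1) \<open>b \<in> B\<close> by (auto simp: conds_def fat_conditions_def)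
      have "pairing (exps d) (?c F) (taylor (Q r) (i, j)) = 0"
        using \<open>F \<in> ?L\<close> r by (intro vanishes_at_affine_point[of d F m]) (auto simp: linear_system_def)
      then show ?thesis by (simp add: r pairing_trunc)
    qed
  qed (simp_all add: fB finite_monomials)
  then show ?thesis by (simp add: B card_monomials)
qed

lemma poly_scale_eq_mult: "poly_scale c F = poly_const c * F"
  unfolding poly_scale_def poly_const_def by (rule mult_map_scale_conv_mult)

lemma poly_subst_superset:
  assumes "finite A" "keys F \<subseteq> A"
  shows "poly_subst g F = (\<Sum>e\<in>A. poly_const (lookup F e) * (\<Prod>j\<in>UNIV. g j ^ lookup e j))"
  unfolding poly_subst_def using assms
  by (intro sum.mono_neutral_left) (auto simp: in_keys_iff poly_const_def)

lemma poly_subst_add: "poly_subst g (F + G) = poly_subst g F + poly_subst g G"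
proof -
  have "keys (F + G) \<subseteq> keys F \<union> keys G" by (rule keys_add)
  then show ?thesis
    by (simp add: poly_subst_superset[of "keys F \<union> keys G"] lookup_add poly_const_def single_add
        distrib_right sum.distrib)
qed

lemma poly_subst_scale: "poly_subst g (poly_scale c F) = poly_scale c (poly_subst g F)"
proof -
  have sub: "keys (poly_scale c F) \<subseteq> keys F" by (auto simp: in_keys_iff lookup_poly_scale)
  have "poly_const (c * a) = poly_const c * poly_const a" for a
    by (simp add: poly_const_def mult_single)
  then show ?thesis
    unfolding poly_scale_eq_mult[of c "poly_subst g F"] poly_subst_superset[OF finite_keys sub]
    by (simp add: poly_subst_def lookup_poly_scale sum_distrib_left mult.assoc)
qed

lemma card_local_exponents:
  "finite {e :: monomial3. lookup e i = 0 \<and> mon_degree e < m}"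
  "card {e :: monomial3. lookup e i = 0 \<and> mon_degree e < m} \<le> m * (m + 1) div 2"
proof -
  let ?S = "{e :: monomial3. lookup e i = 0 \<and> mon_degree e < m}"
  obtain j k where jk: "UNIV = {i, j, k}" "i \<noteq> j" "i \<noteq> k" "j \<noteq> k" by (rule other_indices)
  have deg: "mon_degree e = lookup e i + lookup e j + lookup e k" for e
    unfolding mon_degree_def jk(1) using jk(2-4) by simp
  let ?h = "\<lambda>e :: monomial3. (lookup e j, lookup e k)"
  have inj: "inj_on ?h ?S"
  proof (rule inj_onI, rule poly_mapping_eqI)
    fix e e' l assume "e \<in> ?S" "e' \<in> ?S" "?h e = ?h e'"
    moreover have "l \<in> {i, j, k}" using jk(1) by blast
    ultimately show "lookup e l = lookup e' l" by auto
  qed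
  have sub: "?h ` ?S \<subseteq> {(a, b). a + b < m}" by (auto simp: deg)
  show "finite ?S" by (rule finite_imageD[OF finite_subset[OF sub finite_lt_pairs] inj])
  have "card ?S = card (?h ` ?S)" using inj by (simp add: card_image)
  also have "\<dots> \<le> m * (m + 1) div 2"
    using card_mono[OF finite_lt_pairs sub] by (simp add: card_lt_pairs)
  finally show "card ?S \<le> m * (m + 1) div 2" .
qed

text \<open>One chart per point suffices, by \<open>taylor_order_chart_independent\<close>; in it, multiplicity \<open>m\<close> is
  expressed by one equation for each monomial of degree less than \<open>m\<close> in two local coordinates.\<close>

lemma linear_system_dim_ge:
  "card (exps d) \<le> poly3.dim (linear_system d m n q) + n * (m * (m + 1) div 2)"
proof -
  have "\<exists>v i. q r = abs_proj_plane v \<and> v \<noteq> 0 \<and> v $ i \<noteq> 0" for r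
  proof -
    let ?v = "rep_proj_plane (q r)"
    have "abs_proj_plane ?v = q r" by (rule Quotient_abs_rep[OF Quotient_proj_plane])
    moreover have "?v \<noteq> 0"
      using Quotient_rep_reflp[OF Quotient_proj_plane, of "q r"] by (simp add: proportional_refl)
    moreover from this have "\<exists>i. ?v $ i \<noteq> 0" by (simp add: vec_eq_iff)
    ultimately show ?thesis by metis
  qed
  then obtain v c where v: "\<And>r. q r = abs_proj_plane (v r)" "\<And>r. v r \<noteq> 0" "\<And>r. v r $ c r \<noteq> 0"
    by metis
  let ?S = "\<lambda>r. {e. lookup e (c r) = 0 \<and> mon_degree e < m}"
  let ?J = "SIGMA r:{..<n}. ?S r"
  let ?f = "\<lambda>x F. lookup (taylor_expansion (c (fst x)) (v (fst x)) F) (snd x)"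
  let ?U = "{F. homogeneous d F}"
  have van: "vanishes_to_order m F (q r) \<longleftrightarrow>
      (\<forall>i. v r $ i \<noteq> 0 \<longrightarrow> (\<forall>e\<in>keys (taylor_expansion i (v r) F). m \<le> mon_degree e))" for F r
    unfolding v(1) by (subst vanishes_to_order.abs_eq) (simp_all add: proportional_refl v(2))
  have "linear_system d m n q = {F \<in> ?U. \<forall>x\<in>?J. ?f x F = 0}"
  proof (intro set_eqI iffI)
    fix F assume F: "F \<in> linear_system d m n q"
    have "?f x F = 0" if "x \<in> ?J" for x
    proof -
      obtain r e where re: "x = (r, e)" by (cases x)
      then have x: "x = (r, e)" "r < n" "mon_degree e < m" using that by auto
      then have "\<forall>e\<in>keys (taylor_expansion (c r) (v r) F). m \<le> mon_degree e"
        using F v(3) by (auto simp: linear_system_def van)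
      then show ?thesis using x by (auto simp: in_keys_iff not_le[symmetric])
    qed
    then show "F \<in> {F \<in> ?U. \<forall>x\<in>?J. ?f x F = 0}" using F by (auto simp: linear_system_def)
  next
    fix F assume "F \<in> {F \<in> ?U. \<forall>x\<in>?J. ?f x F = 0}"
    then have F: "homogeneous d F" and zero: "\<And>x. x \<in> ?J \<Longrightarrow> ?f x F = 0" by auto
    have "vanishes_to_order m F (q r)" if r: "r < n" for r
    proof -
      have "\<forall>e\<in>keys (taylor_expansion (c r) (v r) F). m \<le> mon_degree e"
      proof (rule ballI, rule ccontr)
        fix e assume e: "e \<in> keys (taylor_expansion (c r) (v r) F)" and "\<not> m \<le> mon_degree e"
        then have "(r, e) \<in> ?J"
          using local_poly_taylor[OF F, of "c r" "v r"] r by (auto simp: local_poly_def)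
        from zero[OF this] show False using e by (simp add: in_keys_iff)
      qed
      then show ?thesis unfolding van using taylor_order_chart_independent[OF F v(3)] by blast
    qed
    then show "F \<in> linear_system d m n q" using F by (simp add: linear_system_def)
  qed
  moreover have "poly3.dim ?U \<le> poly3.dim {F \<in> ?U. \<forall>x\<in>?J. ?f x F = 0} + card ?J"
  proof (rule poly3.dim_common_kernel_ge[OF _ subspace_homogeneous finite_monomials homogeneous_span])
    show "finite ?J" using card_local_exponents(1) by (intro finite_SigmaI) auto
  qed (simp_all add: taylor_expansion_def poly_subst_add poly_subst_scale lookup_add lookup_poly_scale)
  moreover have "card ?J \<le> n * (m * (m + 1) div 2)"
  proof -
    have "card ?J = (\<Sum>r<n. card (?S r))" using card_local_exponents(1) by (intro card_SigmaI) auto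
    also have "\<dots> \<le> (\<Sum>r<n. m * (m + 1) div 2)" by (intro sum_mono card_local_exponents(2))
    finally show ?thesis by simp
  qed
  ultimately show ?thesis by (simp add: dim_homogeneous)
qed

lemma non_special_if_max_rank:
  assumes "max_rank d m n"
  shows "non_special d m n"
proof -
  define N M where "N = card (exps d)" and "M = n * (m * (m + 1) div 2)"
  obtain Q where Q: "inj_on Q {..<n}" "min N M \<le> rk (conds d (\<lambda>_. m) n Q)"
    using max_rank_distinct[OF assms] by (auto simp: N_def M_def)
  have "exps d = {(i, j). i + j < Suc d}" by (auto simp: exps_def)
  then have "N = Suc d * (Suc d + 1) div 2" unfolding N_def using card_lt_pairs by simp
  also have "Suc d * (Suc d + 1) = d * (d + 3) + 2 * 1" by (simp add: algebra_simps)
  also have "(d * (d + 3) + 2 * 1) div 2 = d * (d + 3) div 2 + 1" by simp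
  finally have virt: "virtual_dim d m n = int N - 1 - int M"
    by (simp add: virtual_dim_def M_def)
  have ge: "expected_dim d m n \<le> linear_system_dim d m n q" for q
    using linear_system_dim_ge[of d m n q]
    unfolding expected_dim_def virt linear_system_dim_def N_def[symmetric] M_def[symmetric] by linarith
  have "linear_system_dim d m n (affine_point \<circ> Q) \<le> expected_dim d m n"
    using linear_system_dim_le_rank[of d m n Q] Q(2)
    unfolding expected_dim_def virt linear_system_dim_def N_def[symmetric] by linarith
  then have "expected_dim d m n = linear_system_dim d m n (affine_point \<circ> Q)" using ge by (rule antisym[rotated])
  moreover have "inj_on (affine_point \<circ> Q) {..<n}"
    using Q(1) inj_affine_point by (meson comp_inj_on inj_on_subset subset_UNIV)
  ultimately have "general_dim d m n = expected_dim d m n"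
    unfolding general_dim_def using ge by (intro Least_equality) auto
  then show ?thesis unfolding non_special_def .
qed

theorem theorem3:
  fixes d m h :: nat
  assumes "m \<ge> 1"
  shows "non_special d m (9 ^ h)"
  using max_rank_nine_power by (rule non_special_if_max_rank)

end
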